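(* Let $\Gamma\in(\mathcal{K}_\infty\cup\{0\})^{N\times N}$ be irreducible, $\mu_1,\dots,\mu_N$ monotone aggregation functions, and assume the induced operator $\Gamma_\mu$ satisfies the small gain condition $\Gamma_\mu(s)\not\ge s$ for all $s\in\mathbb{R}^N_+\setminus\{0\}$. Let $\kappa_0>0$, $\kappa_\Gamma>\kappa_h>0$, let $\phi$ be as in the context, and let $c\in\mathbb{R}^N$ with $c\gg0$, $\|c\|<\kappa_\Gamma/2$, such that $(c,0)$ lies in the interior of an $N$-simplex $\tau^0$ of $\tilde K_1(\delta)$ contained in $\mathbb{R}^N_+\times\{0\}$. Put $\Gamma_\mu^{\max}:=\Gamma_\mu\big((\kappa_\Gamma+\kappa_0)e\big)$, choose $k\in\mathbb{N}$ with $\frac{1}{2k-1}\Gamma_\mu^{\max}\ll c$, and let $$0<\delta<\min\Big\{\frac{\kappa_\Gamma-\kappa_h}{2\sqrt N},\ \frac{\kappa_\Gamma+2\kappa_0}{2k\sqrt N}\Big\}.$$ Let $\eta^0$ be the unique $(N+1)$-simplex of $\tilde K_1(\delta)$ having $\tau^0$ as a facet. Then the connected component of $G$ containing $\eta^0$ is a finite simple path that starts at $\eta^0$ and ends at an $(N+1)$-simplex having a complete facet $\tau=\langle (v^1,1),\dots,(v^{N+1},1)\rangle\subset\mathbb{R}^N_+\times\{1\}$. Moreover, if $(\delta_m)_m$ is a sequence of such admissible $\delta$ with $\delta_m\to0$, and $v^*_m=\sum_j\lambda_jv^j$ is the point obtained from the terminal complete facet for $\delta_m$ with $\lambda\in\mathbb{R}^{N+1}_+$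 solving $L(\tau)\lambda=e_1$, then every accumulation point $s$ of $(v^*_m)$ is a fixed point of $\phi$ and satisfies $\Gamma_\mu(s)\ll s$.
   Context: Order on $\mathbb{R}^N$: $v\ge w$ iff $v_i\ge w_i$ for all $i$; $v>w$ iff $v\ge w$, $v\ne w$; $v\gg w$ iff $v_i>w_i$ for all $i$. $\|\cdot\|$ Euclidean norm, $e=(1,\dots,1)^\top$. $\mathcal{K}_\infty$: continuous, strictly increasing, unbounded $\gamma:\mathbb{R}_+\to\mathbb{R}_+$ with $\gamma(0)=0$; $0$ denotes the zero function. A monotone aggregation function is a continuous $\mu_i:\mathbb{R}^N_+\to\mathbb{R}_+$ with $\mu_i(s)=0$ iff $s=0$, $\mu_i(s)<\mu_i(t)$ whenever $s\ll t$, and $\mu_i(s)\to\infty$ as $\|s\|\to\infty$. The induced operator is $\Gamma_\mu(s)_i=\mu_i(\gamma_{i1}(s_1),\dots,\gamma_{iN}(s_N))$. $\Gamma$ is irreducible if the $0$-$1$ matrix with $(i,j)$ entry $1$ iff $\gamma_{ij}\not\equiv0$ is irreducible. Given $\kappa_0>0$, $\kappa_\Gamma>\kappa_h>0$, $\phi(v)=\Gamma_\mu(v)\big(1+\min\{0,\frac{\kappa_\Gamma-2\|v\|}{\|v\|+\kappa_0}\}\big)+\max\{0,\kappa_h-2\|v\|\}e$ for $v\in\mathbb{R}^N_+$. Triangulation $\tilde K_1(\delta)$: with $P=\mathrm{diag}(\delta,\dots,\delta,1)$, its $(N+1)$-simplices are $\langle y^1,\dots,y^{N+2}\rangle$ with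 $y^1=(\delta z,0)$, $z\in\mathbb{Z}^N$, $y^{i+1}=y^i+Pe_{\pi(i)}$ for a permutation $\pi$ of $\{1,\dots,N+1\}$; its $N$-simplices are the facets of these. We consider only the simplices contained in $\mathbb{R}^N_+\times[0,1]$. Homotopy $\vartheta(v,t)=(1-t)c+t\phi(v)$; labeling $l(v,t)=\vartheta(v,t)-v$ for $(v,t)\in\mathbb{R}^N_+\times\{0,1\}$. Labeling matrix $L(\tau)$ of an $N$-simplex $\tau=\langle y^1,\dots,y^{N+1}\rangle$: the $(N+1)\times(N+1)$ matrix with $j$-th column $(1,l(y^j)^\top)^\top$. $W\succ0$ (lexicographically positive) means the first nonzero entry of each row of $W$ is positive. $\tau$ is complete if $L(\tau)W=I_{N+1}$ has a solution $W\succ0$. Graph $G$: its nodes are the $(N+1)$-simplices (in $\mathbb{R}^N_+\times[0,1]$) having at least one complete facet; two nodes are joined by an edge if they share a common complete facet. *)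

theory Defs
  imports "HOL-Analysis.Analysis"
begin

text \<open>Dimension N = CARD('n); coordinates are indexed by a finite linearly ordered type 'n
  (the order fixes the coordinate order 1..N used in lexicographic positivity).
  Points of R^N x R are pairs (v, t).\<close>

definition nonneg_orthant :: "(real^'n) set" where
  "nonneg_orthant = {s. \<forall>i. 0 \<le> s $ i}"

definition onevec :: "real^'n" where
  "onevec = (\<chi> i. 1)"

definition Kinf :: "(real \<Rightarrow> real) \<Rightarrow> bool" where
  "Kinf g \<longleftrightarrow> continuous_on {0..} g \<and> strict_mono_on {0..} g \<and> g 0 = 0
      \<and> (\<forall>M. \<exists>x\<ge>0. g x > M)"

definition zero_fun_R :: "(real \<Rightarrow> real) \<Rightarrow> bool" where
  "zero_fun_R g \<longleftrightarrow> (\<forall>x\<ge>0. g x = 0)"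

text \<open>Irreducibility of the 0-1 matrix (entry (i,j) = 1 iff gamma_ij is not the zero function),
  expressed through its directed graph: every i reaches every j by a path of length >= 1.\<close>
definition irreducible_gain :: "('n \<Rightarrow> 'n \<Rightarrow> real \<Rightarrow> real) \<Rightarrow> bool" where
  "irreducible_gain g \<longleftrightarrow> (\<forall>i j. (\<lambda>a b. \<not> zero_fun_R (g a b))\<^sup>+\<^sup>+ i j)"

definition MAF :: "(real^'n \<Rightarrow> real) \<Rightarrow> bool" where
  "MAF mu \<longleftrightarrow> continuous_on nonneg_orthant mu
     \<and> (\<forall>s\<in>nonneg_orthant. 0 \<le> mu s)
     \<and> (\<forall>s\<in>nonneg_orthant. mu s = 0 \<longleftrightarrow> s = 0)
     \<and> (\<forall>s\<in>nonneg_orthant. \<forall>t\<in>nonneg_orthant. (\<forall>i. s $ i < t $ i) \<longrightarrow> mu s < mu t)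
     \<and> (\<forall>M. \<exists>R. \<forall>s\<in>nonneg_orthant. norm s \<ge> R \<longrightarrow> mu s \<ge> M)"

definition Gamma_mu :: "('n \<Rightarrow> real^'n \<Rightarrow> real) \<Rightarrow> ('n \<Rightarrow> 'n \<Rightarrow> real \<Rightarrow> real) \<Rightarrow> real^'n \<Rightarrow> real^'n" where
  "Gamma_mu mu g s = (\<chi> i. mu i (\<chi> j. g i j (s $ j)))"

definition phi_map :: "real \<Rightarrow> real \<Rightarrow> real \<Rightarrow> ('n \<Rightarrow> real^'n \<Rightarrow> real) \<Rightarrow> ('n \<Rightarrow> 'n \<Rightarrow> real \<Rightarrow> real)
    \<Rightarrow> real^'n \<Rightarrow> real^'n" where
  "phi_map k0 kG kh mu g v =
     (1 + min 0 ((kG - 2 * norm v) / (norm v + k0))) *\<^sub>R Gamma_mu mu g v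
     + max 0 (kh - 2 * norm v) *\<^sub>R onevec"

text \<open>Triangulation K1~(delta): direction P e_(Some i) = (delta e_i, 0), P e_None = (0,1)
  (None plays the role of the (N+1)-st coordinate).\<close>
definition tri_step :: "real \<Rightarrow> 'n::finite option \<Rightarrow> (real^'n) \<times> real" where
  "tri_step d u = (case u of None \<Rightarrow> (0, 1) | Some i \<Rightarrow> (d *\<^sub>R axis i 1, 0))"

definition tri_verts :: "real \<Rightarrow> int^'n \<Rightarrow> 'n option list \<Rightarrow> ((real^'n) \<times> real) set" where
  "tri_verts d z ps =
     (\<lambda>m. (d *\<^sub>R (\<chi> j. of_int (z $ j)), 0) + sum_list (map (tri_step d) (take m ps))) ` {0..length ps}"

definition simplex1 :: "real \<Rightarrow> ((real^'n) \<times> real) set \<Rightarrow> bool" where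
  "simplex1 d V \<longleftrightarrow> (\<exists>z ps. distinct ps \<and> set ps = UNIV \<and> V = tri_verts d z ps)"

definition facet :: "'a set \<Rightarrow> 'a set \<Rightarrow> bool" where
  "facet V F \<longleftrightarrow> (\<exists>y\<in>V. F = V - {y})"

definition simplex0 :: "real \<Rightarrow> ((real^'n) \<times> real) set \<Rightarrow> bool" where
  "simplex0 d F \<longleftrightarrow> (\<exists>V. simplex1 d V \<and> facet V F)"

definition region :: "((real^'n) \<times> real) set" where
  "region = {(v, t). (\<forall>i. 0 \<le> v $ i) \<and> 0 \<le> t \<and> t \<le> 1}"

definition label :: "real^'n \<Rightarrow> (real^'n \<Rightarrow> real^'n) \<Rightarrow> (real^'n) \<times> real \<Rightarrow> real^'n" where
  "label c F y = (1 - snd y) *\<^sub>R c + snd y *\<^sub>R F (fst y) - fst y"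

definition Lentry :: "((real^'n) \<times> real \<Rightarrow> real^'n) \<Rightarrow> (real^'n) \<times> real \<Rightarrow> 'n option \<Rightarrow> real" where
  "Lentry lab y r = (case r of None \<Rightarrow> 1 | Some i \<Rightarrow> lab y $ i)"

definition lexpos_row :: "('n::linorder option \<Rightarrow> real) \<Rightarrow> bool" where
  "lexpos_row w \<longleftrightarrow> 0 < w None \<or>
     (w None = 0 \<and> (\<exists>i. 0 < w (Some i) \<and> (\<forall>j<i. w (Some j) = 0)))"

definition complete :: "(((real, 'n::{finite,linorder}) vec) \<times> real \<Rightarrow> (real, 'n) vec) \<Rightarrow> (((real, 'n) vec) \<times> real) set \<Rightarrow> bool" where
  "complete lab F \<longleftrightarrow> (\<exists>W.
      (\<forall>y\<in>F. lexpos_row (W y)) \<and>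
      (\<forall>r c. (\<Sum>y\<in>F. Lentry lab y r * W y c) = (if r = c then 1 else 0)))"

definition Gnode :: "real \<Rightarrow> (((real, 'n::{finite,linorder}) vec) \<times> real \<Rightarrow> (real, 'n) vec) \<Rightarrow> (((real, 'n) vec) \<times> real) set \<Rightarrow> bool" where
  "Gnode d lab V \<longleftrightarrow> simplex1 d V \<and> convex hull V \<subseteq> region \<and> (\<exists>F. facet V F \<and> complete lab F)"

definition Gadj :: "real \<Rightarrow> (((real, 'n::{finite,linorder}) vec) \<times> real \<Rightarrow> (real, 'n) vec) \<Rightarrow> (((real, 'n) vec) \<times> real) set
    \<Rightarrow> (((real, 'n) vec) \<times> real) set \<Rightarrow> bool" where
  "Gadj d lab V1 V2 \<longleftrightarrow> Gnode d lab V1 \<and> Gnode d lab V2 \<and> V1 \<noteq> V2 \<and>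
     (\<exists>F. facet V1 F \<and> facet V2 F \<and> complete lab F)"

definition component_is_path :: "real \<Rightarrow> (((real, 'n::{finite,linorder}) vec) \<times> real \<Rightarrow> (real, 'n) vec)
    \<Rightarrow> (((real, 'n) vec) \<times> real) set \<Rightarrow> (((real, 'n) vec) \<times> real) set list \<Rightarrow> bool" where
  "component_is_path d lab eta0 p \<longleftrightarrow>
     p \<noteq> [] \<and> distinct p \<and> hd p = eta0 \<and>
     set p = {V. (Gadj d lab)\<^sup>*\<^sup>* eta0 V} \<and>
     (\<forall>a\<in>set p. \<forall>b\<in>set p. Gadj d lab a b \<longleftrightarrow>
        (\<exists>i. Suc i < length p \<and> ((a = p ! i \<and> b = p ! Suc i) \<or> (b = p ! i \<and> a = p ! Suc i)))) \<and>
     (\<exists>F. facet (last p) F \<and> complete lab F \<and> (\<forall>y\<in>F. snd y = 1))"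

definition admissible :: "real \<Rightarrow> real \<Rightarrow> real \<Rightarrow> nat \<Rightarrow> (real, 'n::finite) vec \<Rightarrow> real
    \<Rightarrow> (((real, 'n) vec) \<times> real) set \<Rightarrow> (((real, 'n) vec) \<times> real) set \<Rightarrow> bool" where
  "admissible k0 kG kh k c d tau0 eta0 \<longleftrightarrow>
     0 < d \<and> d < (kG - kh) / (2 * sqrt (real CARD('n)))
     \<and> d < (kG + 2 * k0) / (2 * real k * sqrt (real CARD('n)))
     \<and> simplex0 d tau0 \<and> convex hull tau0 \<subseteq> region \<and> (\<forall>y\<in>tau0. snd y = 0)
     \<and> (c, 0) \<in> rel_interior (convex hull tau0)
     \<and> simplex1 d eta0 \<and> convex hull eta0 \<subseteq> region \<and> facet eta0 tau0"

end

(* A lexicographic ratio test shows that a simplex with one complete facet has exactly two, and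
   every facet outside the levels 0 and 1 lies in exactly two simplices.  Hence G has maximal degree two,
   and along the component of eta^0 the only ways to stop are facets in the boundary of the region.
   Level 0 carries no complete facet except tau^0, because c lies in the relative interior of a unique
   simplex there.  On a lateral face {v_i = 0}, irreducibility forces some coordinate of the homotopy
   that vanishes on the carrier of the barycentric solution to be positive.  Far out, the choice of k
   makes phi <= c, so that the barycentric solution has norm at most |c|, which is too small.
   Therefore the path is finite and ends at level 1.  A limit of the level 1 solutions is a fixed
   point s of phi.  If |s| > kappa_Gamma / 2, then s is at most Gamma(s), contradicting the small gain
   condition; otherwise s exceeds Gamma(s) by a multiple of e, which the same condition makes positive. *)

theory Submission
  imports Defs
begin

section \<open>Integer simplices of the triangulation\<close>

text \<open>Two obstacles shape the development. Labels may be degenerate: barycentric solutions can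
  have zero weights, and a ratio test on these weights alone can tie. Comparing whole rows of the
  inverse label matrix lexicographically breaks every tie without perturbing the data. The other
  obstacle is that a base point and a permutation describe a simplex badly once a vertex is
  exchanged. Simplices are therefore treated as maximal chains of integer points in a unit cube,
  graded by the coordinate sum, and an exchange becomes arithmetic with consecutive heights.

  The radius kappa_Gamma + kappa_0 is where the damping factor of phi vanishes. With q =
  (kappa_Gamma + 2 kappa_0)/(2k), that factor equals 1/(2k-1) at radius kappa_Gamma + kappa_0 - q,
  and delta sqrt N < q keeps every simplex that reaches the outer radius beyond the inner one.

  If the last simplex had no complete facet at level 1, each of its complete facets other than tau^0
  would lead to a neighbour. Away from eta^0 these neighbours coincide, since the last vertex of a
  path has only one; but the two facets together already contain all vertices of the
  simplex.\<close>

definition height :: "('a::finite \<Rightarrow> int) \<Rightarrow> int" where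
  "height x = (\<Sum>i\<in>UNIV. x i)"

text \<open>Not transitive: two unit steps in the same coordinate leave the cube. Requiring the
  relation for all pairs, and not only for consecutive points, is what confines a chain to a single
  unit cube.\<close>

definition kuhn_rel :: "('a \<Rightarrow> int) \<Rightarrow> ('a \<Rightarrow> int) \<Rightarrow> bool" where
  "kuhn_rel x y \<longleftrightarrow> (\<forall>i. x i \<le> y i \<and> y i \<le> x i + 1)"

text \<open>A chain of maximal size in a unit cube: its heights are consecutive integers, so this is the
  vertex set of a simplex of Freudenthal's triangulation without reference to a permutation.\<close>
definition kuhn :: "('a::finite \<Rightarrow> int) set \<Rightarrow> bool" where
  "kuhn X \<longleftrightarrow> finite X \<and> card X = Suc CARD('a) \<and> (\<forall>x\<in>X. \<forall>y\<in>X. kuhn_rel x y \<or> kuhn_rel y x)"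

lemma height_mono: "(\<And>i. x i \<le> y i) \<Longrightarrow> height x \<le> height y"
  by (simp add: height_def sum_mono)

lemma height_eq_imp_eq:
  assumes "\<And>i. x i \<le> y i" "height x = height y"
  shows "x = y"
proof
  fix i
  have "(\<Sum>i\<in>UNIV. y i - x i) = 0" using assms by (simp add: height_def sum_subtractf)
  then show "x i = y i" using assms(1) by (subst (asm) sum_nonneg_eq_0_iff) auto
qed

lemma height_add_one: "height (\<lambda>i. x i + 1) = height x + int CARD('a)" for x :: "'a::finite \<Rightarrow> int"
  by (simp add: height_def sum.distrib)

lemma height_diff_one: "height (\<lambda>i. x i - 1) = height x - int CARD('a)" for x :: "'a::finite \<Rightarrow> int"
  by (simp add: height_def sum_subtractf)

lemma kuhn_rel_height:
  fixes x y :: "'a::finite \<Rightarrow> int"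
  assumes "kuhn_rel x y"
  shows "height x \<le> height y" "height y \<le> height x + int CARD('a)"
  using assms height_mono[of x y] height_mono[of y "\<lambda>i. x i + 1"]
  by (auto simp: kuhn_rel_def height_add_one)

lemma kuhn_rel_eq: "kuhn_rel x y \<Longrightarrow> height y \<le> height x \<Longrightarrow> x = y"
  using height_eq_imp_eq[of x y] kuhn_rel_height(1)[of x y] by (auto simp: kuhn_rel_def)

lemma kuhn_rel_refl [simp]: "kuhn_rel x x"
  by (simp add: kuhn_rel_def)

lemma kuhnD:
  assumes "kuhn X" "x \<in> X" "y \<in> X" "height x \<le> height y"
  shows "kuhn_rel x y"
  using assms kuhn_rel_eq[of y x] by (auto simp: kuhn_def)

lemma kuhn_height_inj:
  assumes "kuhn X" "x \<in> X" "y \<in> X" "height x = height y"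
  shows "x = y"
  using kuhn_rel_eq[OF kuhnD[OF assms(1-3)]] assms(4) by auto

text \<open>Pigeonhole: the heights are pairwise distinct and lie in a window with exactly as many
  integers as the chain has points, so every height occurs. The point at the greatest height then
  has to be the opposite corner of the cube based at the lowest point.\<close>

lemma kuhn_heights:
  fixes X :: "('a::finite \<Rightarrow> int) set"
  assumes X: "kuhn X"
  obtains z where "z \<in> X" "(\<lambda>i. z i + 1) \<in> X" "height ` X = {height z..height z + int CARD('a)}"
    "\<And>x. x \<in> X \<Longrightarrow> kuhn_rel z x"
proof -
  have fin: "finite X" "X \<noteq> {}" using X by (auto simp: kuhn_def)
  then obtain z where z: "z \<in> X" "\<And>x. x \<in> X \<Longrightarrow> height z \<le> height x"
    by (metis arg_min_if_finite(1) arg_min_least)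
  have rel: "kuhn_rel z x" if "x \<in> X" for x using kuhnD[OF X z(1) that z(2)[OF that]] .
  have "inj_on height X" using kuhn_height_inj[OF X] by (auto intro: inj_onI)
  then have "card (height ` X) = Suc CARD('a)" using X by (simp add: card_image kuhn_def)
  moreover have "height ` X \<subseteq> {height z..height z + int CARD('a)}"
    using z(2) kuhn_rel_height(2)[OF rel] by auto
  ultimately have eq: "height ` X = {height z..height z + int CARD('a)}"
    by (intro card_subset_eq) auto
  then have "height z + int CARD('a) \<in> height ` X" by auto
  then obtain t where t: "t \<in> X" "height t = height z + int CARD('a)" by auto
  have "t = (\<lambda>i. z i + 1)"
    using height_eq_imp_eq[of t "\<lambda>i. z i + 1"] rel[OF t(1)] t(2)
    by (auto simp: kuhn_rel_def height_add_one)
  then show thesis using that z eq rel t by auto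
qed

text \<open>Recovers one entry of the permutation from two vertices of consecutive height.\<close>

lemma kuhn_rel_Suc_height:
  fixes x y :: "'a::finite \<Rightarrow> int"
  assumes "kuhn_rel x y" "height y = height x + 1"
  obtains i where "y = x(i := x i + 1)"
proof -
  have "\<exists>i. y i > x i" using assms height_mono[of y x] by (metis add_le_same_cancel1 not_less not_one_le_zero)
  then obtain i where i: "y i = x i + 1" using assms(1) by (metis kuhn_rel_def add1_zle_eq order_antisym)
  let ?x = "x(i := x i + 1)"
  have "height ?x = height x + 1"
    by (simp add: height_def sum.remove[of UNIV i] sum.remove[of UNIV i x])
  then have "?x = y" using assms i by (intro height_eq_imp_eq) (auto simp: kuhn_rel_def)
  then show thesis using that by blast
qed

lemma kuhn_insertI:
  fixes X :: "('a::finite \<Rightarrow> int) set"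
  assumes X: "kuhn X" "y \<in> X" and w: "w \<notin> X"
    and rel: "\<And>x. x \<in> X - {y} \<Longrightarrow> kuhn_rel x w \<or> kuhn_rel w x"
  shows "kuhn (insert w (X - {y}))"
  using assms unfolding kuhn_def by (auto simp: card_Suc_Diff1)

text \<open>An interval has no gaps, so an integer added outside it must be adjacent to it, and the
  integer given up must be the opposite end.\<close>

lemma int_interval_shift:
  fixes a b h y D :: int
  assumes "1 \<le> D" "a \<le> y" "y \<le> a + D" "h < a \<or> a + D < h"
    and iff: "\<And>m. m = h \<or> (a \<le> m \<and> m \<le> a + D \<and> m \<noteq> y) \<longleftrightarrow> b \<le> m \<and> m \<le> b + D"
  shows "(y = a \<and> h = a + D + 1) \<or> (y = a + D \<and> h = a - 1)"
  using assms(4)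
proof
  assume h: "h < a"
  have b: "b = h" using iff[of b] iff[of h] h assms(1) by linarith
  have "h = a - 1" using iff[of "h + 1"] b h assms(1) by linarith
  then show ?thesis using iff[of "a + D"] b assms(1-3) by linarith
next
  assume h: "a + D < h"
  have b: "b + D = h" using iff[of "b + D"] iff[of h] h assms(1) by linarith
  have "h = a + D + 1" using iff[of "h - 1"] b h assms(1) by linarith
  then show ?thesis using iff[of a] b assms(1-3) by linarith
qed

text \<open>Heights decide the shape of the other coface: a missing interior height must be refilled, while
  dropping the bottom or top vertex allows the opposite end to be extended by a full period.\<close>
lemma kuhn_other_coface:
  fixes X :: "('a::finite \<Rightarrow> int) set"
  assumes X: "kuhn X" and y: "y \<in> X"
  shows "\<exists>y'. y' \<notin> X \<and> kuhn (insert y' (X - {y})) \<and>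
    (\<forall>w. w \<notin> X - {y} \<longrightarrow> kuhn (insert w (X - {y})) \<longrightarrow> w = y \<or> w = y')"
proof -
  let ?F = "X - {y}" and ?D = "int CARD('a)"
  obtain z where z: "z \<in> X" "(\<lambda>i. z i + 1) \<in> X" and H: "height ` X = {height z..height z + ?D}"
    and zrel: "\<And>x. x \<in> X \<Longrightarrow> kuhn_rel z x"
    using kuhn_heights[OF X] by blast
  define t where "t = (\<lambda>i. z i + 1)"
  have ht: "height t = height z + ?D" by (simp add: t_def height_add_one)
  have tX: "t \<in> X" using z by (simp add: t_def)
  have D1: "?D \<ge> 1" using zero_less_card_finite[where 'a='a] by linarith
  have hb: "height z \<le> height x" "height x \<le> height z + ?D" if "x \<in> X" for x
    using H that by auto
  have ex: "\<exists>x\<in>X. height x = m" if "height z \<le> m" "m \<le> height z + ?D" for m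
  proof -
    have "m \<in> height ` X" using that H by auto
    then show ?thesis by auto
  qed
  have ne: "height x \<noteq> height y" if "x \<in> ?F" for x
    using kuhn_height_inj[OF X _ y] that by blast
  have hw: "height w = height y \<or> (y = z \<and> height w = height z + ?D + 1) \<or> (y = t \<and> height w = height z - 1)"
    if w: "w \<notin> ?F" "kuhn (insert w ?F)" for w
  proof -
    let ?h = "height w"
    obtain z' :: "'a \<Rightarrow> int" where H': "height ` insert w ?F = {height z'..height z' + ?D}"
      by (rule kuhn_heights[OF w(2)]) (rule that)
    have "height x \<noteq> ?h" if "x \<in> ?F" for x
      using kuhn_height_inj[OF w(2), of x w] w(1) that by blast
    moreover have F: "height ` ?F = {height z..height z + ?D} - {height y}"
    proof
      show "height ` ?F \<subseteq> {height z..height z + ?D} - {height y}" using hb ne by auto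
      show "{height z..height z + ?D} - {height y} \<subseteq> height ` ?F"
      proof
        fix m assume m: "m \<in> {height z..height z + ?D} - {height y}"
        then obtain x where "x \<in> X" "height x = m" using ex[of m] by auto
        then show "m \<in> height ` ?F" using m by (intro image_eqI[of _ _ x]) auto
      qed
    qed
    ultimately have wn: "?h \<notin> {height z..height z + ?D} - {height y}" by (metis imageE)
    have "insert ?h ({height z..height z + ?D} - {height y}) = {height z'..height z' + ?D}"
      using H' F by simp
    then have iff: "m = ?h \<or> (height z \<le> m \<and> m \<le> height z + ?D \<and> m \<noteq> height y) \<longleftrightarrow> height z' \<le> m \<and> m \<le> height z' + ?D" for m
      by (simp add: set_eq_iff)
    show ?thesis
    proof (cases "?h = height y")
      case False
      then have "?h < height z \<or> height z + ?D < ?h" using wn by auto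
      from int_interval_shift[OF D1 hb[OF y] this iff] show ?thesis
        using kuhn_height_inj[OF X y z(1)] kuhn_height_inj[OF X y tX] ht by auto
    qed simp
  qed
  consider "y = z" | "y = t" | "y \<noteq> z" "y \<noteq> t" by blast
  then show ?thesis
  proof cases
    case 1
    obtain a where a: "a \<in> X" "height a = height z + 1" using ex[of "height z + 1"] D1 by auto
    \<comment> \<open>Without the bottom vertex, \<open>a\<close> becomes the lowest point, and the
      new top is the opposite corner of the cube based at \<open>a\<close>. Case 2 is the mirror
      image.\<close>
    define y' where "y' = (\<lambda>i. a i + 1)"
    have hy': "height y' = height z + ?D + 1" using a by (simp add: y'_def height_add_one)
    have aF: "a \<in> ?F" using a 1 by auto
    have arel: "kuhn_rel a x" if "x \<in> ?F" for x
    proof -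
      have "height x \<noteq> height z" using ne that 1 by simp
      then show ?thesis using kuhnD[OF X a(1), of x] hb[of x] a that by auto
    qed
    have "y' \<notin> X" using hb(2)[of y'] hy' by auto
    moreover have "kuhn (insert y' ?F)"
    proof (rule kuhn_insertI[OF X y \<open>y' \<notin> X\<close>])
      fix x assume "x \<in> ?F"
      then show "kuhn_rel x y' \<or> kuhn_rel y' x" using arel[of x] by (auto simp: kuhn_rel_def y'_def)
    qed
    moreover have "w = y \<or> w = y'" if w: "w \<notin> ?F" "kuhn (insert w ?F)" for w
      using hw[OF w]
    proof (elim disjE conjE)
      assume "height w = height y"
      moreover have tF: "t \<in> ?F" using tX 1 ht D1 by auto
      ultimately have "kuhn_rel w t" using kuhnD[OF w(2), of w t] ht 1 by auto
      then show ?thesis using height_eq_imp_eq[of z w] \<open>height w = height y\<close> 1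
        by (auto simp: kuhn_rel_def t_def)
    next
      assume h: "height w = height z + ?D + 1"
      then have "kuhn_rel a w" using kuhnD[OF w(2), of a w] aF a D1 by auto
      then show ?thesis using height_eq_imp_eq[of w y'] h hy' by (auto simp: kuhn_rel_def y'_def)
    next
      assume "y = t" then show ?thesis using 1 ht D1 by auto
    qed
    ultimately show ?thesis by blast
  next
    case 2
    obtain a where a: "a \<in> X" "height a = height z + ?D - 1" using ex[of "height z + ?D - 1"] D1 by auto
    define y' where "y' = (\<lambda>i. a i - 1)"
    have hy': "height y' = height z - 1" using a by (simp add: y'_def height_diff_one)
    have aF: "a \<in> ?F" using a 2 ht by auto
    have arel: "kuhn_rel x a" if "x \<in> ?F" for x
    proof -
      have "height x \<noteq> height z + ?D" using ne that 2 ht by simp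
      then show ?thesis using kuhnD[OF X _ a(1), of x] hb[of x] a that by auto
    qed
    have "y' \<notin> X" using hb(1)[of y'] hy' by auto
    moreover have "kuhn (insert y' ?F)"
    proof (rule kuhn_insertI[OF X y \<open>y' \<notin> X\<close>])
      fix x assume "x \<in> ?F"
      then show "kuhn_rel x y' \<or> kuhn_rel y' x" using arel[of x]
        by (auto simp: kuhn_rel_def y'_def algebra_simps)
    qed
    moreover have "w = y \<or> w = y'" if w: "w \<notin> ?F" "kuhn (insert w ?F)" for w
      using hw[OF w]
    proof (elim disjE conjE)
      assume h: "height w = height y"
      have zF: "z \<in> ?F" using z 2 ht D1 by auto
      have "kuhn_rel z w" using kuhnD[OF w(2), of z w] zF h 2 ht by auto
      then show ?thesis using height_eq_imp_eq[of w t] h 2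
        by (auto simp: kuhn_rel_def t_def)
    next
      assume "y = z" then show ?thesis using 2 ht D1 by auto
    next
      assume h: "height w = height z - 1"
      then have "kuhn_rel w a" using kuhnD[OF w(2), of w a] aF a D1 by auto
      then have "y' i \<le> w i" for i by (auto simp: kuhn_rel_def y'_def diff_le_eq)
      then show ?thesis using height_eq_imp_eq[of y' w] h hy' by auto
    qed
    ultimately show ?thesis by blast
  next
    case 3
    have hy: "height z < height y" "height y < height z + ?D"
      using hb[OF y] kuhn_height_inj[OF X y z(1)] kuhn_height_inj[OF X y tX] 3 ht
      by (auto simp: less_le)
    obtain a where a: "a \<in> X" "height a = height y - 1" using ex[of "height y - 1"] hy by auto
    obtain b where b: "b \<in> X" "height b = height y + 1" using ex[of "height y + 1"] hy by auto
    have ay: "kuhn_rel a y" and yb: "kuhn_rel y b" and ab: "kuhn_rel a b"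
      using kuhnD[OF X a(1) y] kuhnD[OF X y b(1)] kuhnD[OF X a(1) b(1)] a b by auto
    obtain i where i: "y = a(i := a i + 1)" using kuhn_rel_Suc_height[OF ay] a by auto
    obtain j where j: "b = y(j := y j + 1)" using kuhn_rel_Suc_height[OF yb] b by auto
    have ij: "i \<noteq> j"
    proof
      assume "i = j"
      then have "b i = a i + 2" using i j by simp
      moreover have "b i \<le> a i + 1" using ab by (simp add: kuhn_rel_def)
      ultimately show False by simp
    qed
    \<comment> \<open>On the way from \<open>a\<close> over \<open>y\<close> to \<open>b\<close>
      coordinate \<open>i\<close> is raised, then \<open>j\<close>. The exchanged vertex makes the
      two steps in the other order, a transposition of neighbours in the permutation.\<close>
    define y' where "y' = a(j := a j + 1)"
    have hy': "height y' = height y"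
      using a by (simp add: y'_def height_def sum.remove[of UNIV j] sum.remove[of UNIV j a])
    have between: "a u \<le> y' u \<and> y' u \<le> b u" for u using i j by (auto simp: y'_def)
    have y'y: "y' \<noteq> y" using ij i by (auto simp: y'_def fun_eq_iff)
    then have "y' \<notin> X" using kuhn_height_inj[OF X y] hy' by metis
    moreover have "kuhn (insert y' ?F)"
    proof (rule kuhn_insertI[OF X y \<open>y' \<notin> X\<close>])
      fix x assume x: "x \<in> ?F"
      then have "height x \<noteq> height y" using ne by simp
      then consider "height x \<le> height a" | "height b \<le> height x" using a b by linarith
      then show "kuhn_rel x y' \<or> kuhn_rel y' x"
      proof cases
        case 1
        then have r: "kuhn_rel x a" "kuhn_rel x b"
          using kuhnD[OF X _ a(1), of x] kuhnD[OF X _ b(1), of x] x a b by auto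
        have "kuhn_rel x y'" unfolding kuhn_rel_def
        proof
          fix u
          have "x u \<le> a u" "b u \<le> x u + 1" using r by (simp_all add: kuhn_rel_def)
          then show "x u \<le> y' u \<and> y' u \<le> x u + 1" using between[of u] by linarith
        qed
        then show ?thesis ..
      next
        case 2
        then have r: "kuhn_rel a x" "kuhn_rel b x"
          using kuhnD[OF X a(1), of x] kuhnD[OF X b(1), of x] x a b by auto
        have "kuhn_rel y' x" unfolding kuhn_rel_def
        proof
          fix u
          have "x u \<le> a u + 1" "b u \<le> x u" using r by (simp_all add: kuhn_rel_def)
          then show "y' u \<le> x u \<and> x u \<le> y' u + 1" using between[of u] by linarith
        qed
        then show ?thesis ..
      qed
    qed
    moreover have "w = y \<or> w = y'" if w: "w \<notin> ?F" "kuhn (insert w ?F)" for w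
    proof -
      have h: "height w = height y" using hw[OF w] 3 by auto
      have F: "a \<in> ?F" "b \<in> ?F" using a b by auto
      have aw: "kuhn_rel a w" and wb: "kuhn_rel w b"
        using kuhnD[OF w(2), of a w] kuhnD[OF w(2), of w b] F a b h by auto
      obtain k where k: "w = a(k := a k + 1)" using kuhn_rel_Suc_height[OF aw] a h by auto
      \<comment> \<open>Between \<open>a\<close> and \<open>b\<close> only the coordinates
        \<open>i\<close> and \<open>j\<close> grow, so there is no third candidate of this
        height.\<close>
      have "w k \<le> b k" using wb by (simp add: kuhn_rel_def)
      then have "k = i \<or> k = j" using k i j by (auto split: if_splits)
      then show ?thesis using k i by (auto simp: y'_def)
    qed
    ultimately show ?thesis by blast
  qed
qed

section \<open>Integer chains as simplices of the triangulation: facets, cofaces and levels\<close>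

definition emb :: "real \<Rightarrow> ('n::finite option \<Rightarrow> int) \<Rightarrow> (real^'n) \<times> real" where
  "emb d x = (d *\<^sub>R (\<chi> j. of_int (x (Some j))), of_int (x None))"

lemma emb_inj: "0 < d \<Longrightarrow> inj (emb d)"
proof (rule injI)
  fix x y assume d: "0 < d" and "emb d x = emb d y"
  then have "x None = y None" "\<And>i. x (Some i) = y (Some i)"
    by (auto simp: emb_def vec_eq_iff)
  then show "x = y" by (intro ext) (metis option.exhaust)
qed

lemma emb_add: "emb d (\<lambda>u. x u + y u) = emb d x + emb d y"
  by (simp add: emb_def vec_eq_iff algebra_simps)

lemma sum_list_tri_step:
  "distinct xs \<Longrightarrow> sum_list (map (tri_step d) xs) = emb d (\<lambda>u. if u \<in> set xs then 1 else 0)"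
proof (induction xs)
  case Nil
  then show ?case by (simp add: emb_def vec_eq_iff zero_prod_def)
next
  case (Cons u xs)
  have "tri_step d u = emb d (\<lambda>v. if v = u then 1 else 0)"
    by (cases u) (auto simp: emb_def tri_step_def vec_eq_iff axis_def)
  moreover have "(\<lambda>v. if v \<in> set (u # xs) then 1 else (0::int)) =
      (\<lambda>v. (if v = u then 1 else 0) + (if v \<in> set xs then 1 else 0))"
    using Cons.prems by auto
  ultimately show ?case using Cons by (simp only: list.map sum_list.Cons distinct.simps emb_add)
qed

text \<open>Turns a full flag of subsets into the permutation whose prefixes they are.\<close>

lemma chain_as_list_prefixes:
  assumes "\<And>m. m \<le> n \<Longrightarrow> finite (S m) \<and> card (S m) = m" "\<And>m. m < n \<Longrightarrow> S m \<subseteq> S (Suc m)"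
  shows "\<exists>ps. length ps = n \<and> distinct ps \<and> (\<forall>m\<le>n. set (take m ps) = S m)"
  using assms
proof (induction n)
  case 0
  then show ?case using card_0_eq[of "S 0"] by auto
next
  case (Suc n)
  then obtain ps where ps: "length ps = n" "distinct ps" "\<And>m. m \<le> n \<Longrightarrow> set (take m ps) = S m"
    by (metis le_SucI less_SucI)
  have "S n \<subseteq> S (Suc n)" "finite (S n)" "finite (S (Suc n))" "card (S n) = n" "card (S (Suc n)) = Suc n"
    using Suc.prems by auto
  then have "card (S (Suc n) - S n) = 1" by (simp add: card_Diff_subset)
  then obtain a where a: "S (Suc n) - S n = {a}" by (auto simp: card_1_singleton_iff)
  then have Sn: "S (Suc n) = insert a (S n)" "a \<notin> S n" using \<open>S n \<subseteq> S (Suc n)\<close> by auto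
  have "set ps = S n" using ps(3)[of n] ps(1) by simp
  then have "length (ps @ [a]) = Suc n \<and> distinct (ps @ [a]) \<and> (\<forall>m\<le>Suc n. set (take m (ps @ [a])) = S m)"
    using ps Sn by (auto simp: le_Suc_eq)
  then show ?case by blast
qed

text \<open>The level condition replaces the normalisation that the base vertex has level 0: the
  lowest and the highest point differ by one in every coordinate, so if both levels are in {0, 1},
  the lowest has level 0. The permutation is recovered from the sets \<open>S m\<close> of
  coordinates already raised after \<open>m\<close> steps, which form a full flag.\<close>

lemma simplex1_iff_kuhn:
  fixes V :: "((real^'n::finite) \<times> real) set"
  shows "simplex1 d V \<longleftrightarrow> (\<exists>X. kuhn X \<and> (\<forall>x\<in>X. x None \<in> {0, 1}) \<and> V = emb d ` X)"
proof
  assume "simplex1 d V"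
  then obtain z and ps :: "'n option list" where ps: "distinct ps" "set ps = UNIV"
    and V: "V = tri_verts d z ps"
    unfolding simplex1_def by blast
  define z' where "z' u = (case u of None \<Rightarrow> 0 | Some j \<Rightarrow> z $ j)" for u
  define x where "x m u = z' u + (if u \<in> set (take m ps) then 1 else 0)" for m u
  have len: "length ps = CARD('n option)" using ps distinct_card by metis
  have "(d *\<^sub>R (\<chi> j. of_int (z $ j)), 0) + sum_list (map (tri_step d) (take m ps)) = emb d (x m)" for m
  proof -
    have "(d *\<^sub>R (\<chi> j. of_int (z $ j)), 0) = emb d z'" by (simp add: emb_def z'_def)
    then show ?thesis using ps(1) by (simp add: sum_list_tri_step x_def[abs_def] emb_add)
  qed
  then have "V = emb d ` x ` {0..length ps}" by (simp add: V tri_verts_def image_image)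
  moreover have "kuhn (x ` {0..length ps})"
  proof -
    have "inj_on x {0..length ps}"
    proof (rule inj_onI)
      fix m m' assume m: "m \<in> {0..length ps}" "m' \<in> {0..length ps}" and eq: "x m = x m'"
      have "u \<in> set (take m ps) \<longleftrightarrow> u \<in> set (take m' ps)" for u
        using fun_cong[OF eq, of u] by (auto simp: x_def split: if_splits)
      then have "set (take m ps) = set (take m' ps)" by blast
      then have "card (set (take m ps)) = card (set (take m' ps))" by simp
      moreover have "card (set (take m ps)) = m" "card (set (take m' ps)) = m'"
        using m ps(1) by (simp_all add: distinct_card)
      ultimately show "m = m'" by simp
    qed
    then have "card (x ` {0..length ps}) = Suc CARD('n option)" by (simp only: card_image len) simp
    moreover have "kuhn_rel (x m) (x m')" if "m \<le> m'" for m m'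
      using set_take_subset_set_take[OF that, of ps] by (auto simp: kuhn_rel_def x_def)
    ultimately show ?thesis unfolding kuhn_def by (auto simp del: card_option) (metis nle_le)
  qed
  moreover have "\<forall>y\<in>x ` {0..length ps}. y None \<in> {0, 1}" by (auto simp: x_def z'_def)
  ultimately show "\<exists>X. kuhn X \<and> (\<forall>x\<in>X. x None \<in> {0, 1}) \<and> V = emb d ` X" by blast
next
  assume "\<exists>X. kuhn X \<and> (\<forall>x\<in>X. x None \<in> {0, 1}) \<and> V = emb d ` X"
  then obtain X where X: "kuhn X" and lev: "\<And>x. x \<in> X \<Longrightarrow> x None \<in> {0, 1}" and V: "V = emb d ` X"
    by blast
  let ?D = "CARD('n option)"
  obtain z where z: "z \<in> X" "(\<lambda>i. z i + 1) \<in> X" and H: "height ` X = {height z..height z + int ?D}"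
    and zrel: "\<And>x. x \<in> X \<Longrightarrow> kuhn_rel z x"
    using kuhn_heights[OF X] by blast
  have z0: "z None = 0" using lev[OF z(1)] lev[OF z(2)] by auto
  have "\<exists>y\<in>X. height y = height z + int m" if "m \<le> ?D" for m
  proof -
    have "height z + int m \<in> height ` X" unfolding H using that by simp
    then show ?thesis by (metis imageE)
  qed
  then obtain x where x: "\<And>m. m \<le> ?D \<Longrightarrow> x m \<in> X \<and> height (x m) = height z + int m" by metis
  define S where "S m = {u. x m u = z u + 1}" for m
  have xS: "x m u = z u + (if u \<in> S m then 1 else 0)" if "m \<le> ?D" for m u
    using zrel[of "x m"] x[OF that] unfolding kuhn_rel_def S_def by (smt (verit) mem_Collect_eq)
  have cardS: "card (S m) = m" if "m \<le> ?D" for m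
  proof -
    have "height (x m) = height z + (\<Sum>u\<in>UNIV. if u \<in> S m then 1 else 0)"
      by (simp add: height_def xS[OF that] sum.distrib)
    also have "(\<Sum>u\<in>UNIV. if u \<in> S m then 1 else 0) = int (card (S m))"
      by (simp flip: sum.inter_filter)
    finally show ?thesis using x[OF that] by simp
  qed
  have sub: "S m \<subseteq> S (Suc m)" if "m < ?D" for m
  proof -
    have m: "m \<le> ?D" "Suc m \<le> ?D" using that by auto
    have "kuhn_rel (x m) (x (Suc m))" using kuhnD[OF X, of "x m" "x (Suc m)"] x[OF m(1)] x[OF m(2)] by auto
    then have *: "x m u \<le> x (Suc m) u" for u by (simp add: kuhn_rel_def)
    show ?thesis
    proof
      fix u assume "u \<in> S m"
      then show "u \<in> S (Suc m)" using *[of u] xS[OF m(1), of u] xS[OF m(2), of u]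
        by (auto split: if_splits)
    qed
  qed
  obtain ps where ps: "length ps = ?D" "distinct ps" "\<And>m. m \<le> ?D \<Longrightarrow> set (take m ps) = S m"
    using chain_as_list_prefixes[of ?D S] cardS sub by auto
  have U: "set ps = UNIV"
    using ps(1,2) by (intro card_subset_eq) (auto simp: distinct_card simp del: card_option)
  have emb: "(d *\<^sub>R (\<chi> j. of_int ((\<chi> j. z (Some j)) $ j)), 0) + sum_list (map (tri_step d) (take m ps)) = emb d (x m)"
    if "m \<le> ?D" for m
  proof -
    have "(d *\<^sub>R (\<chi> j. of_int ((\<chi> j. z (Some j)) $ j)), 0) = emb d z" by (simp add: emb_def z0)
    moreover have "x m = (\<lambda>u. z u + (if u \<in> set (take m ps) then 1 else 0))"
      using xS[OF that] ps(3)[OF that] by auto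
    ultimately show ?thesis using ps(2) by (simp add: sum_list_tri_step emb_add)
  qed
  have "X = x ` {0..?D}"
  proof
    show "x ` {0..?D} \<subseteq> X" using x by auto
    show "X \<subseteq> x ` {0..?D}"
    proof
      fix y assume y: "y \<in> X"
      then have "height y \<in> {height z..height z + int ?D}" unfolding H[symmetric] by (rule imageI)
      then obtain m where m: "m \<le> ?D" "height y = height z + int m"
        by (metis add_le_cancel_left atLeastAtMost_iff nonneg_int_cases of_nat_le_iff zle_iff_zadd)
      then have "y = x m" using kuhn_height_inj[OF X y] x[OF m(1)] by simp
      then show "y \<in> x ` {0..?D}" using m by simp
    qed
  qed
  moreover have "tri_verts d (\<chi> j. z (Some j)) ps = (\<lambda>m. emb d (x m)) ` {0..?D}"
    unfolding tri_verts_def ps(1)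
  proof (rule image_cong[OF refl])
    fix m assume "m \<in> {0..?D}"
    then have "m \<le> ?D" unfolding atLeastAtMost_iff by blast
    then show "(d *\<^sub>R (\<chi> j. of_int ((\<chi> j. z (Some j)) $ j)), 0) + sum_list (map (tri_step d) (take m ps)) = emb d (x m)"
      by (rule emb)
  qed
  ultimately have "V = tri_verts d (\<chi> j. z (Some j)) ps" unfolding V by (metis image_image)
  then show "simplex1 d V" unfolding simplex1_def using ps U by blast
qed

lemma simplex1_card:
  fixes V :: "((real^'n::finite) \<times> real) set"
  assumes "0 < d" "simplex1 d V"
  shows "finite V" "card V = Suc CARD('n option)"
proof -
  obtain X where X: "kuhn X" "V = emb d ` X" using assms(2) by (auto simp: simplex1_iff_kuhn)
  have "inj_on (emb d) X" using emb_inj[OF assms(1)] by (rule inj_on_subset) simp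
  then show "finite V" "card V = Suc CARD('n option)"
    using X unfolding kuhn_def by (simp_all only: card_image finite_imageI)
qed

lemma facet_emb:
  assumes d: "0 < d" and "facet (emb d ` X) F"
  obtains y where "y \<in> X" "F = emb d ` (X - {y})"
proof -
  obtain y where y: "y \<in> X" "F = emb d ` X - {emb d y}" using assms(2) by (auto simp: facet_def)
  then have "F = emb d ` (X - {y})"
    using image_set_diff[OF emb_inj[OF d], of X "{y}"] by simp
  then show thesis using that y by blast
qed

text \<open>The exchanged vertex \<open>y'\<close> always exists as an integer point, but its level
  can fall outside {0, 1}. Existence of a second coface is therefore not claimed; the last
  conclusion only says that any second coface must use \<open>y'\<close>.\<close>

lemma coface_cases:
  fixes V :: "((real^'n::finite) \<times> real) set"
  assumes d: "0 < d" and V: "simplex1 d V" and F: "facet V F"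
  obtains X y y' where "kuhn X" "y \<in> X" "V = emb d ` X" "F = emb d ` (X - {y})" "y' \<notin> X"
    "kuhn (insert y' (X - {y}))" "\<And>x. x \<in> X \<Longrightarrow> x None \<in> {0, 1}"
    "\<And>V'. simplex1 d V' \<Longrightarrow> facet V' F \<Longrightarrow> V' \<noteq> V \<Longrightarrow>
      V' = emb d ` insert y' (X - {y}) \<and> y' None \<in> {0, 1}"
proof -
  obtain X where X: "kuhn X" "\<And>x. x \<in> X \<Longrightarrow> x None \<in> {0, 1}" "V = emb d ` X"
    using V simplex1_iff_kuhn[of d V] by metis
  obtain y where y: "y \<in> X" "F = emb d ` (X - {y})" using facet_emb[OF d] F X(3) by metis
  obtain y' where y': "y' \<notin> X" "kuhn (insert y' (X - {y}))"
    and uniq: "\<And>w. w \<notin> X - {y} \<Longrightarrow> kuhn (insert w (X - {y})) \<Longrightarrow> w = y \<or> w = y'"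
    using kuhn_other_coface[OF X(1) y(1)] by blast
  have "V' = emb d ` insert y' (X - {y}) \<and> y' None \<in> {0, 1}"
    if V': "simplex1 d V'" "facet V' F" "V' \<noteq> V" for V'
  proof -
    obtain X' where X': "kuhn X'" "\<And>x. x \<in> X' \<Longrightarrow> x None \<in> {0, 1}" "V' = emb d ` X'"
      using V' simplex1_iff_kuhn[of d V'] by metis
    obtain w where w: "w \<in> X'" "F = emb d ` (X' - {w})" using facet_emb[OF d] V' X'(3) by metis
    have "X - {y} = X' - {w}" using y(2) w(2) inj_image_eq_iff[OF emb_inj[OF d]] by metis
    then have eq: "X' = insert w (X - {y})" "w \<notin> X - {y}" using w by auto
    then have "w = y \<or> w = y'" using uniq X'(1) by simp
    moreover have "w \<noteq> y" using V'(3) X'(3) X(3) eq y(1) by (metis insert_Diff)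
    ultimately show ?thesis using eq X' w by auto
  qed
  then show thesis using that X y y' by blast
qed

lemma coface_unique:
  fixes V :: "((real^'n::finite) \<times> real) set"
  assumes "0 < d" "simplex1 d V" "facet V F" "simplex1 d V1" "facet V1 F" "simplex1 d V2" "facet V2 F"
    "V1 \<noteq> V" "V2 \<noteq> V"
  shows "V1 = V2"
  using coface_cases[OF assms(1-3)] assms(4-9) by metis

lemma region_iff_emb:
  assumes "0 < d"
  shows "emb d x \<in> region \<longleftrightarrow> (\<forall>u. 0 \<le> x u) \<and> x None \<le> 1"
proof -
  have "(\<forall>u. 0 \<le> x u) \<longleftrightarrow> 0 \<le> x None \<and> (\<forall>i. 0 \<le> x (Some i))" by (metis option.exhaust)
  then show ?thesis using assms by (auto simp: region_def emb_def zero_le_mult_iff)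
qed

text \<open>Every coordinate of the exchanged vertex is within one of that of each vertex of
  \<open>F\<close>. One vertex of \<open>F\<close> with a positive integer coordinate keeps that
  coordinate nonnegative, and one vertex below level 1 keeps the level at most 1; \<open>nb\<close>
  supplies such vertices.\<close>

lemma coface_exists:
  fixes V :: "((real^'n::finite) \<times> real) set"
  assumes d: "0 < d" and V: "simplex1 d V" "V \<subseteq> region" and F: "facet V F"
    and nb: "\<not> (\<forall>y\<in>F. snd y = 0)" "\<not> (\<forall>y\<in>F. snd y = 1)" "\<And>i. \<not> (\<forall>y\<in>F. fst y $ i = 0)"
  shows "\<exists>V'. V' \<noteq> V \<and> simplex1 d V' \<and> V' \<subseteq> region \<and> facet V' F"
proof -
  obtain X y y' where X: "kuhn X" "y \<in> X" "V = emb d ` X" "F = emb d ` (X - {y})" "y' \<notin> X"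
    "kuhn (insert y' (X - {y}))" "\<And>x. x \<in> X \<Longrightarrow> x None \<in> {0, 1}"
    using coface_cases[OF d V(1) F] by metis
  have near: "x u \<le> y' u + 1 \<and> y' u \<le> x u + 1" if "x \<in> X - {y}" for x u
  proof -
    have "kuhn_rel x y' \<or> kuhn_rel y' x" using X(6) that unfolding kuhn_def by blast
    then show ?thesis unfolding kuhn_rel_def by (elim disjE) (drule spec[of _ u], linarith)+
  qed
  have pos: "0 \<le> x u" if "x \<in> X" for x u
    using V(2) that region_iff_emb[OF d] X(3) by blast
  have "\<exists>x\<in>X - {y}. x (Some i) \<noteq> 0" for i using nb(3)[of i] X(4) d by (auto simp: emb_def)
  then have 1: "0 \<le> y' (Some i)" for i
  proof -
    obtain x where "x \<in> X - {y}" "x (Some i) \<noteq> 0" using \<open>\<exists>x\<in>X - {y}. x (Some i) \<noteq> 0\<close> by blast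
    then show ?thesis using near[of x "Some i"] pos[of x "Some i"] by auto
  qed
  obtain x where "x \<in> X - {y}" "x None \<noteq> 0" using nb(1) X(4) by (auto simp: emb_def)
  then have 2: "0 \<le> y' None" using near[of x None] pos[of x None] by auto
  obtain x where "x \<in> X - {y}" "x None \<noteq> 1" using nb(2) X(4) by (auto simp: emb_def)
  then have 3: "y' None \<le> 1" using near[of x None] X(7)[of x] by auto
  let ?V = "emb d ` insert y' (X - {y})"
  have "simplex1 d ?V" unfolding simplex1_iff_kuhn
  proof (intro exI conjI ballI)
    show "x None \<in> {0, 1}" if "x \<in> insert y' (X - {y})" for x
      using that X(7)[of x] 2 3 by auto
  qed (use X in auto)
  moreover have y'0: "0 \<le> y' u" for u using 1 2 by (cases u) auto
  then have "?V \<subseteq> region" using V(2) X(3) 3 by (auto simp: region_iff_emb[OF d])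
  moreover have "emb d y' \<notin> V" using X(3,5) inj_image_mem_iff[OF emb_inj[OF d]] by metis
  then have "?V \<noteq> V" by blast
  moreover have "facet ?V F"
    unfolding facet_def
  proof
    show "F = ?V - {emb d y'}" using \<open>emb d y' \<notin> V\<close> X(3,4) by auto
  qed simp
  ultimately show ?thesis by (intro exI[of _ ?V] conjI)
qed

text \<open>The lowest and the highest vertex differ in level, so the highest one is at level 1 and
  must be the vertex that was removed.\<close>

lemma level0_facet:
  fixes X :: "('n::finite option \<Rightarrow> int) set"
  assumes X: "kuhn X" "y \<in> X" and lev: "\<forall>x\<in>X. x None \<in> {0, 1}"
    and zero: "\<forall>x\<in>X - {y}. x None = 0"
  obtains z where "z \<in> X - {y}" "y = (\<lambda>u. z u + 1)" "\<And>x. x \<in> X \<Longrightarrow> kuhn_rel z x"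
    "height ` X = {height z..height z + int CARD('n option)}"
proof -
  obtain z where z: "z \<in> X" "(\<lambda>i. z i + 1) \<in> X" "height ` X = {height z..height z + int CARD('n option)}"
    "\<And>x. x \<in> X \<Longrightarrow> kuhn_rel z x"
    using kuhn_heights[OF X(1)] by blast
  have "z None = 0" using bspec[OF lev z(1)] bspec[OF lev z(2)] by auto
  have y: "y = (\<lambda>u. z u + 1)"
  proof (rule ccontr)
    assume "y \<noteq> (\<lambda>u. z u + 1)"
    then have "(\<lambda>u. z u + 1) \<in> X - {y}" using z(2) by blast
    from bspec[OF zero this] show False using \<open>z None = 0\<close> by simp
  qed
  have "z \<noteq> y" using fun_cong[of z y None] unfolding y by auto
  with y show thesis using that z by blast
qed

text \<open>The missing vertex is the all-ones translate of the lowest vertex, and that vertex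
  belongs to the facet and is determined by it. This is what leaves the start simplex with only one
  exit.\<close>

lemma level0_coface_unique:
  fixes V :: "((real^'n::finite) \<times> real) set"
  assumes d: "0 < d" and V: "simplex1 d V" "facet V F" and V': "simplex1 d V'" "facet V' F"
    and lev: "\<forall>y\<in>F. snd y = 0"
  shows "V' = V"
proof (rule ccontr)
  assume "V' \<noteq> V"
  obtain X y y' where X: "kuhn X" "y \<in> X" "V = emb d ` X" "F = emb d ` (X - {y})" "y' \<notin> X"
    "kuhn (insert y' (X - {y}))" "\<And>x. x \<in> X \<Longrightarrow> x None \<in> {0, 1}" and y': "y' None \<in> {0, 1}"
    using coface_cases[OF d V] V' \<open>V' \<noteq> V\<close> by metis
  have zero: "\<forall>x\<in>X - {y}. x None = 0" using lev X(4) by (auto simp: emb_def)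
  have levX: "\<forall>x\<in>X. x None \<in> {0, 1}" using X(7) by blast
  obtain z where z: "z \<in> X - {y}" "y = (\<lambda>u. z u + 1)" "\<And>x. x \<in> X \<Longrightarrow> kuhn_rel z x"
    using level0_facet[OF X(1,2) levX zero] by blast
  have eq: "insert y' (X - {y}) - {y'} = X - {y}" using X(5) by auto
  have lev': "\<forall>x\<in>insert y' (X - {y}). x None \<in> {0, 1}" using levX y' by blast
  have zero': "\<forall>x\<in>insert y' (X - {y}) - {y'}. x None = 0" unfolding eq by (rule zero)
  obtain z' where "z' \<in> insert y' (X - {y}) - {y'}" "y' = (\<lambda>u. z' u + 1)"
      "\<And>x. x \<in> insert y' (X - {y}) \<Longrightarrow> kuhn_rel z' x"
    by (rule level0_facet[OF X(6) insertI1 lev' zero']) (rule that)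
  then have z': "z' \<in> X - {y}" "y' = (\<lambda>u. z' u + 1)" "\<And>x. x \<in> insert y' (X - {y}) \<Longrightarrow> kuhn_rel z' x"
    using eq by auto
  have "kuhn_rel z z'" "kuhn_rel z' z" using z z' by auto
  then have "z = z'" by (intro ext) (auto simp: kuhn_rel_def intro: order_antisym)
  then show False using z z' X(2,5) by simp
qed

lemma simplex1_vertex_near:
  assumes d: "0 < d" and V: "simplex1 d V" and xy: "x \<in> V" "y \<in> V"
  shows "\<bar>fst x $ i - fst y $ i\<bar> \<le> d"
proof -
  obtain X where X: "kuhn X" "V = emb d ` X" using V by (auto simp: simplex1_iff_kuhn)
  obtain a b where ab: "a \<in> X" "x = emb d a" "b \<in> X" "y = emb d b" using xy X(2) by auto
  have "kuhn_rel a b \<or> kuhn_rel b a" using X(1) ab unfolding kuhn_def by blast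
  then have "\<bar>a (Some i) - b (Some i)\<bar> \<le> 1"
    unfolding kuhn_rel_def by (elim disjE) (drule spec[of _ "Some i"], linarith)+
  then have "\<bar>real_of_int (a (Some i)) - real_of_int (b (Some i))\<bar> \<le> 1" by linarith
  then show ?thesis using d ab
    by (simp add: emb_def abs_mult flip: right_diff_distrib)
qed

lemma simplex1_level:
  assumes "simplex1 d V" "y \<in> V"
  shows "snd y = 0 \<or> snd y = 1"
  using assms by (auto simp: simplex1_iff_kuhn emb_def)

lemma finite_bounded_simplex1:
  assumes d: "0 < d"
  shows "finite {V :: ((real^'n::finite) \<times> real) set. simplex1 d V \<and> V \<subseteq> region \<and> (\<forall>y\<in>V. \<forall>i. fst y $ i \<le> R)}"
    (is "finite ?A")
proof -
  \<comment> \<open>The 1 covers the level coordinate, the floor covers the spatial ones.\<close>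
  define M :: int where "M = max 1 \<lfloor>R / d\<rfloor>"
  let ?B = "{x :: 'n option \<Rightarrow> int. \<forall>u. x u \<in> {0..M}}"
  have "?B = PiE UNIV (\<lambda>_. {0..M})" by auto
  then have "finite ?B" by (simp add: finite_PiE)
  moreover have "?A \<subseteq> Pow (emb d ` ?B)"
  proof (clarsimp)
    fix V :: "((real^'n) \<times> real) set" and a b
    assume V: "simplex1 d V" "V \<subseteq> region" "\<forall>y\<in>V. \<forall>i. fst y $ i \<le> R" "(a, b) \<in> V"
    then obtain x where x: "(a, b) = emb d x" by (auto simp: simplex1_iff_kuhn)
    then have r: "(\<forall>u. 0 \<le> x u) \<and> x None \<le> 1" using V region_iff_emb[OF d, of x] by auto
    have "x u \<le> M" for u
    proof (cases u)
      case (Some i)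
      have "d * of_int (x (Some i)) \<le> R" using V(3,4) x by (auto simp: emb_def)
      then have "of_int (x (Some i)) \<le> R / d" using d by (simp add: field_simps)
      then have "x (Some i) \<le> \<lfloor>R / d\<rfloor>" unfolding le_floor_iff .
      then show ?thesis using Some by (simp add: M_def)
    qed (use r in \<open>auto simp: M_def\<close>)
    then show "(a, b) \<in> emb d ` {x. \<forall>u. 0 \<le> x u \<and> x u \<le> M}" using r x by blast
  qed
  ultimately show ?thesis by (meson finite_Pow_iff finite_imageI finite_subset)
qed

section \<open>Affine independence and uniqueness of the carrier at level 0\<close>

text \<open>Each height \<open>h\<close> above the lowest is reached by raising one coordinate
  \<open>i\<close>, and for vertices of the chain \<open>x i - z i\<close> is the indicator of
  \<open>h \<le> height x\<close>. The relations thus say that all upper tail sums of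
  \<open>w\<close> vanish, and the difference of two consecutive tails is a single weight.\<close>

lemma kuhn_affine_independent:
  fixes X :: "('a::finite \<Rightarrow> int) set" and w :: "('a \<Rightarrow> int) \<Rightarrow> real"
  assumes X: "kuhn X" and s: "(\<Sum>x\<in>X. w x) = 0" and c: "\<And>u. (\<Sum>x\<in>X. w x * of_int (x u)) = 0"
    and x: "x \<in> X"
  shows "w x = 0"
proof -
  have fin: "finite X" using X by (simp add: kuhn_def)
  obtain z where z: "z \<in> X" and H: "height ` X = {height z..height z + int CARD('a)}"
    and zrel: "\<And>x. x \<in> X \<Longrightarrow> kuhn_rel z x"
    by (rule kuhn_heights[OF X]) (rule that)
  have hb: "height z \<le> height x" "height x \<le> height z + int CARD('a)" if "x \<in> X" for x
    using H that by auto
  let ?U = "\<lambda>h. {x\<in>X. h \<le> height x}"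
  have U0: "sum w (?U h) = 0" for h
  proof (cases "h \<le> height z \<or> height z + int CARD('a) < h")
    case True
    then have "?U h = X \<or> ?U h = {}" using hb by force
    then show ?thesis using s by (elim disjE) (simp_all only: sum.empty)
  next
    case False
    then have "h \<in> height ` X" "h - 1 \<in> height ` X" unfolding H by auto
    then obtain a b where a: "a \<in> X" "height a = h - 1" and b: "b \<in> X" "height b = h" by auto
    have ab: "kuhn_rel a b" using kuhnD[OF X a(1) b(1)] a b by auto
    obtain i where i: "b = a(i := a i + 1)" using kuhn_rel_Suc_height[OF ab] a b by auto
    have ai: "a i = z i"
    proof -
      have "z i \<le> a i" "b i \<le> z i + 1" using zrel[OF a(1)] zrel[OF b(1)] by (auto simp: kuhn_rel_def)
      then show ?thesis using i by simp
    qed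
    have eq: "w x * of_int (x i) - w x * of_int (z i) = (if h \<le> height x then w x else 0)" if x: "x \<in> X" for x
    proof (cases "h \<le> height x")
      case True
      have "b i \<le> x i" using kuhnD[OF X b(1) x] True b by (auto simp: kuhn_rel_def)
      moreover have "x i \<le> z i + 1" using zrel[OF x] by (auto simp: kuhn_rel_def)
      ultimately have "x i = z i + 1" using i ai by simp
      then show ?thesis using True by (simp add: algebra_simps)
    next
      case False
      then have "x i \<le> a i" using kuhnD[OF X x a(1)] a by (auto simp: kuhn_rel_def)
      moreover have "z i \<le> x i" using zrel[OF x] by (auto simp: kuhn_rel_def)
      ultimately show ?thesis using ai False by simp
    qed
    have "sum w (?U h) = (\<Sum>x\<in>X. if h \<le> height x then w x else 0)"
      using fin by (simp add: sum.inter_filter)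
    also have "\<dots> = (\<Sum>x\<in>X. w x * of_int (x i) - w x * of_int (z i))"
      by (rule sum.cong) (simp_all add: eq)
    also have "\<dots> = 0" using s c[of i] by (simp add: sum_subtractf flip: sum_distrib_right)
    finally show ?thesis .
  qed
  have "?U (height x) = insert x (?U (height x + 1))"
    using x kuhn_height_inj[OF X x] by force
  then have "sum w (?U (height x)) = w x + sum w (?U (height x + 1))" using fin by simp
  then show ?thesis using U0 by simp
qed

lemma simplex1_affine_independent:
  fixes V :: "((real^'n::finite) \<times> real) set"
  assumes d: "0 < d" and V: "simplex1 d V" and F: "F \<subseteq> V"
    and s: "(\<Sum>y\<in>F. w y) = 0" and c: "(\<Sum>y\<in>F. w y *\<^sub>R y) = 0" and y: "y \<in> F"
  shows "w y = 0"
proof -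
  define w' where "w' y = (if y \<in> F then w y else 0)" for y
  obtain X where X: "kuhn X" "V = emb d ` X" using V by (auto simp: simplex1_iff_kuhn)
  have fin: "finite V" using simplex1_card[OF d V] by simp
  have inj: "inj_on (emb d) X" using emb_inj[OF d] by (rule inj_on_subset) simp
  have s': "(\<Sum>x\<in>X. w' (emb d x)) = 0"
  proof -
    have "(\<Sum>y\<in>V. w' y) = (\<Sum>y\<in>F. w y)"
      unfolding w'_def using fin F by (subst sum.mono_neutral_cong_right[of V F]) auto
    then show ?thesis using s by (simp add: X(2) sum.reindex[OF inj])
  qed
  have c': "(\<Sum>x\<in>X. w' (emb d x) *\<^sub>R emb d x) = 0"
  proof -
    have "(\<Sum>y\<in>V. w' y *\<^sub>R y) = (\<Sum>y\<in>F. w y *\<^sub>R y)"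
      unfolding w'_def using fin F by (subst sum.mono_neutral_cong_right[of V F]) auto
    then show ?thesis using c by (simp add: X(2) sum.reindex[OF inj])
  qed
  have "(\<Sum>x\<in>X. w' (emb d x) * of_int (x u)) = 0" for u
  proof (cases u)
    case None
    from arg_cong[OF c', of snd] show ?thesis by (simp add: None emb_def snd_sum)
  next
    case (Some i)
    from arg_cong[OF c', of "\<lambda>p. fst p $ i"]
    have "(\<Sum>x\<in>X. w' (emb d x) * (d * of_int (x u))) = 0" by (simp add: Some emb_def fst_sum mult.assoc)
    then have "d * (\<Sum>x\<in>X. w' (emb d x) * of_int (x u)) = 0" by (simp add: sum_distrib_left mult.left_commute)
    then show ?thesis using d by simp
  qed
  note kuhn_affine_independent[OF X(1) s' this]
  then have "w' y = 0" using y F X(2) by auto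
  then show ?thesis using y by (simp add: w'_def)
qed

text \<open>Positive weights place \<open>p\<close> strictly inside the unit cube of the first
  simplex, which forces both simplices to have the same base point. Inside one cube a simplex
  prescribes an order of the coordinates of \<open>p - z\<close>. If the chains differ at some
  height, one of them gives a strict inequality between two such coordinates and the other its weak
  reverse.\<close>

lemma level0_carrier_unique:
  fixes X X' :: "('n::finite option \<Rightarrow> int) set" and p :: "'n \<Rightarrow> real"
  assumes X: "kuhn X" "y \<in> X" and lev: "\<forall>x\<in>X. x None \<in> {0, 1}" and zero: "\<forall>x\<in>X - {y}. x None = 0"
    and X': "kuhn X'" "y' \<in> X'" and lev': "\<forall>x\<in>X'. x None \<in> {0, 1}" and zero': "\<forall>x\<in>X' - {y'}. x None = 0"
    and u: "\<And>x. x \<in> X - {y} \<Longrightarrow> 0 < u x" "(\<Sum>x\<in>X - {y}. u x) = 1"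
      "\<And>i. (\<Sum>x\<in>X - {y}. u x * of_int (x (Some i))) = p i"
    and v: "\<And>x. x \<in> X' - {y'} \<Longrightarrow> 0 \<le> v x" "(\<Sum>x\<in>X' - {y'}. v x) = 1"
      "\<And>i. (\<Sum>x\<in>X' - {y'}. v x * of_int (x (Some i))) = p i"
  shows "X' - {y'} = X - {y}"
proof -
  let ?A = "X - {y}" and ?B = "X' - {y'}"
  have fin: "finite ?A" "finite ?B" using X X' by (auto simp: kuhn_def)
  obtain z where z: "z \<in> ?A" "y = (\<lambda>u. z u + 1)" and zrel: "\<And>x. x \<in> X \<Longrightarrow> kuhn_rel z x"
    and H: "height ` X = {height z..height z + int CARD('n option)}"
    by (rule level0_facet[OF X lev zero]) (rule that)
  obtain z' where z': "z' \<in> ?B" "y' = (\<lambda>u. z' u + 1)" and zrel': "\<And>x. x \<in> X' \<Longrightarrow> kuhn_rel z' x"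
    and H': "height ` X' = {height z'..height z' + int CARD('n option)}"
    by (rule level0_facet[OF X' lev' zero']) (rule that)
  have D1: "int CARD('n option) \<ge> 1" using zero_less_card_finite[where 'a="'n option"] by linarith
  have hy: "height y = height z + int CARD('n option)" unfolding z(2) by (rule height_add_one)
  \<comment> \<open>The vertex just below the removed top. The step from \<open>b\<close> to
    \<open>y\<close> can only raise the level, so \<open>b\<close> is the spatial corner opposite to
    \<open>z\<close>; the weights on \<open>z\<close> and \<open>b\<close> keep \<open>p\<close> off
    the boundary of the cube.\<close>
  obtain b where b: "b \<in> ?A" "\<And>i. b (Some i) = z (Some i) + 1"
  proof -
    have "height y - 1 \<in> height ` X" unfolding H hy using D1 by auto
    then obtain b where bX: "b \<in> X" "height b = height y - 1" by auto
    then have bA: "b \<in> ?A" by auto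
    have "kuhn_rel b y" using kuhnD[OF X(1) bX(1) X(2)] bX by simp
    then obtain k where k: "y = b(k := b k + 1)" using kuhn_rel_Suc_height bX(2) by (metis diff_add_cancel)
    have "b None \<noteq> y None" 
    proof -
      have "b None = 0" "z None = 0" using zero bA z(1) by blast+
      then show ?thesis by (simp add: z(2))
    qed
    then have "k = None" using k by (metis fun_upd_apply)
    then have "b (Some i) = z (Some i) + 1" for i using k z(2) by (metis fun_upd_apply option.distinct(1))
    then show thesis using that bA by blast
  qed
  have diffA: "p i - of_int (z (Some i)) = (\<Sum>x\<in>?A. u x * of_int (x (Some i) - z (Some i)))"
    "of_int (z (Some i)) + 1 - p i = (\<Sum>x\<in>?A. u x * of_int (z (Some i) + 1 - x (Some i)))" for i
    using u(2) u(3)[of i]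
    by (simp_all add: algebra_simps sum.distrib sum_subtractf flip: sum_distrib_left sum_distrib_right)
  have diffB: "p i - of_int (z' (Some i)) = (\<Sum>x\<in>?B. v x * of_int (x (Some i) - z' (Some i)))"
    "of_int (z' (Some i)) + 1 - p i = (\<Sum>x\<in>?B. v x * of_int (z' (Some i) + 1 - x (Some i)))" for i
    using v(2) v(3)[of i]
    by (simp_all add: algebra_simps sum.distrib sum_subtractf flip: sum_distrib_left sum_distrib_right)
  have p1: "of_int (z (Some i)) < p i" for i
  proof -
    have "0 < (\<Sum>x\<in>?A. u x * of_int (x (Some i) - z (Some i)))"
    proof (rule sum_pos2[OF fin(1) b(1)])
      show "0 < u b * of_int (b (Some i) - z (Some i))" using u(1)[OF b(1)] b(2) by simp
      show "0 \<le> u x * of_int (x (Some i) - z (Some i))" if "x \<in> ?A" for x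
        using u(1)[OF that] zrel[of x] that by (simp add: kuhn_rel_def)
    qed
    then show ?thesis using diffA(1)[of i] by linarith
  qed
  have p2: "p i < of_int (z (Some i)) + 1" for i
  proof -
    have "0 < (\<Sum>x\<in>?A. u x * of_int (z (Some i) + 1 - x (Some i)))"
    proof (rule sum_pos2[OF fin(1) z(1)])
      show "0 < u z * of_int (z (Some i) + 1 - z (Some i))" using u(1)[OF z(1)] by simp
      show "0 \<le> u x * of_int (z (Some i) + 1 - x (Some i))" if "x \<in> ?A" for x
        using u(1)[OF that] zrel[of x] that
        by (intro mult_nonneg_nonneg) (auto simp: kuhn_rel_def simp flip: of_int_add)
    qed
    then show ?thesis using diffA(2)[of i] by linarith
  qed
  have q: "of_int (z' (Some i)) \<le> p i \<and> p i \<le> of_int (z' (Some i)) + 1" for i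
  proof -
    have "0 \<le> (\<Sum>x\<in>?B. v x * of_int (x (Some i) - z' (Some i)))"
      using v(1) zrel' by (intro sum_nonneg mult_nonneg_nonneg) (auto simp: kuhn_rel_def)
    moreover have "0 \<le> (\<Sum>x\<in>?B. v x * of_int (z' (Some i) + 1 - x (Some i)))"
    proof (intro sum_nonneg mult_nonneg_nonneg v(1))
      fix x assume "x \<in> ?B"
      then have "0 \<le> z' (Some i) + 1 - x (Some i)" using zrel'[of x] by (simp add: kuhn_rel_def)
      then show "0 \<le> real_of_int (z' (Some i) + 1 - x (Some i))" by linarith
    qed
    ultimately show ?thesis using diffB[of i] by linarith
  qed
  have "z' = z"
  proof
    fix w
    show "z' w = z w"
    proof (cases w)
      case None
      have "z None = 0" "z' None = 0" using zero zero' z(1) z'(1) by blast+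
      then show ?thesis using None by simp
    next
      case (Some i)
      have "real_of_int (z (Some i)) < real_of_int (z' (Some i) + 1)"
        "real_of_int (z' (Some i)) < real_of_int (z (Some i) + 1)"
        using p1[of i] p2[of i] q[of i] by simp_all
      then have "z (Some i) < z' (Some i) + 1" "z' (Some i) < z (Some i) + 1"
        unfolding of_int_less_iff .
      then show ?thesis unfolding Some by linarith
    qed
  qed
  have "?A \<subseteq> ?B"
  proof
    fix x assume x: "x \<in> ?A"
    then have "height x \<in> height ` X'" unfolding H' \<open>z' = z\<close> H[symmetric] by auto
    then obtain x' where x': "x' \<in> X'" "height x' = height x" by auto
    have "height x \<noteq> height y" using kuhn_height_inj[OF X(1) _ X(2), of x] x by blast
    then have xB: "x' \<in> ?B" using x' z z' \<open>z' = z\<close> by auto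
    have "x = x'"
    proof (rule ccontr)
      assume ne: "x \<noteq> x'"
      have "\<exists>a. x' a < x a" using height_eq_imp_eq[of x x'] ne x'(2) by (metis not_less)
      then obtain a0 where a0: "x' a0 < x a0" by blast
      have "\<exists>a. x a < x' a" using height_eq_imp_eq[of x' x] ne x'(2) by (metis not_less)
      then obtain b0 where b0: "x b0 < x' b0" by blast
      have "x None = x' None" using bspec[OF zero x] bspec[OF zero' xB] by simp
      then obtain i j where ij: "a0 = Some i" "b0 = Some j" using a0 b0 by (cases a0; cases b0) auto
      have xx: "x (Some i) = z (Some i) + 1" "x (Some j) = z (Some j)"
        "x' (Some i) = z (Some i)" "x' (Some j) = z (Some j) + 1"
      proof -
        have "z w \<le> x w \<and> x w \<le> z w + 1" "z w \<le> x' w \<and> x' w \<le> z w + 1" for w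
          using zrel[of x] x zrel'[of x'] x' \<open>z' = z\<close> by (simp_all add: kuhn_rel_def)
        from this[of a0] this[of b0] a0 b0 show "x (Some i) = z (Some i) + 1" "x (Some j) = z (Some j)"
          "x' (Some i) = z (Some i)" "x' (Some j) = z (Some j) + 1" unfolding ij by linarith+
      qed
      \<comment> \<open>Along \<open>X\<close> coordinate \<open>i\<close> is raised before
        \<open>j\<close>: vertices above \<open>x\<close> already have \<open>i\<close> raised,
        vertices below \<open>x\<close> do not yet have \<open>j\<close> raised. Along
        \<open>X'\<close> the roles are exchanged.\<close>
      have A: "w (Some j) - z (Some j) \<le> w (Some i) - z (Some i)" if w: "w \<in> X" for w
      proof -
        have "kuhn_rel x w \<or> kuhn_rel w x" using X(1) x w unfolding kuhn_def by blast
        moreover have "z (Some i) \<le> w (Some i)" "w (Some j) \<le> z (Some j) + 1"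
          using zrel[OF w] by (simp_all add: kuhn_rel_def)
        moreover have "kuhn_rel x w \<Longrightarrow> x (Some i) \<le> w (Some i)" "kuhn_rel w x \<Longrightarrow> w (Some j) \<le> x (Some j)"
          by (simp_all add: kuhn_rel_def)
        ultimately show ?thesis using xx by linarith
      qed
      have B: "w (Some i) - z (Some i) \<le> w (Some j) - z (Some j)" if w: "w \<in> X'" for w
      proof -
        have "kuhn_rel x' w \<or> kuhn_rel w x'" using X'(1) x' w unfolding kuhn_def by blast
        moreover have "z (Some j) \<le> w (Some j)" "w (Some i) \<le> z (Some i) + 1"
          using zrel'[OF w] \<open>z' = z\<close> by (simp_all add: kuhn_rel_def)
        moreover have "kuhn_rel x' w \<Longrightarrow> x' (Some j) \<le> w (Some j)" "kuhn_rel w x' \<Longrightarrow> w (Some i) \<le> x' (Some i)"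
          by (simp_all add: kuhn_rel_def)
        ultimately show ?thesis using xx by linarith
      qed
      have "(\<Sum>w\<in>?A. u w * of_int (w (Some j) - z (Some j))) < (\<Sum>w\<in>?A. u w * of_int (w (Some i) - z (Some i)))"
      proof (rule sum_strict_mono_ex1[OF fin(1)])
        show "\<forall>w\<in>?A. u w * of_int (w (Some j) - z (Some j)) \<le> u w * of_int (w (Some i) - z (Some i))"
        proof (intro ballI mult_left_mono)
          fix w assume w: "w \<in> ?A"
          then show "real_of_int (w (Some j) - z (Some j)) \<le> real_of_int (w (Some i) - z (Some i))"
            using A[of w] unfolding of_int_le_iff by blast
          show "0 \<le> u w" using u(1)[OF w] by simp
        qed
        show "\<exists>w\<in>?A. u w * of_int (w (Some j) - z (Some j)) < u w * of_int (w (Some i) - z (Some i))"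
          using x u(1)[OF x] xx by (intro bexI[of _ x]) auto
      qed
      moreover have "(\<Sum>w\<in>?B. v w * of_int (w (Some i) - z (Some i))) \<le> (\<Sum>w\<in>?B. v w * of_int (w (Some j) - z (Some j)))"
      proof (intro sum_mono mult_left_mono v(1))
        fix w assume "w \<in> ?B"
        then show "real_of_int (w (Some i) - z (Some i)) \<le> real_of_int (w (Some j) - z (Some j))"
          using B[of w] unfolding of_int_le_iff by blast
      qed
      ultimately show False using diffA(1)[of i] diffA(1)[of j] diffB(1)[of i] diffB(1)[of j] \<open>z' = z\<close> by simp
    qed
    then show "x \<in> ?B" using xB by simp
  qed
  moreover have "card ?A = card ?B" using X X' by (simp add: kuhn_def del: card_option)
  ultimately show ?thesis using card_subset_eq[OF fin(2)] by metis
qed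

section \<open>Lexicographic pivoting\<close>

lemma lexpos_row_add:
  assumes "lexpos_row u" "lexpos_row w"
  shows "lexpos_row (\<lambda>r. u r + w r)"
proof (cases "u None = 0 \<and> w None = 0")
  case True
  obtain i where i: "0 < u (Some i)" "\<forall>j<i. u (Some j) = 0"
    using assms(1) True by (auto simp: lexpos_row_def)
  obtain j where j: "0 < w (Some j)" "\<forall>i<j. w (Some i) = 0"
    using assms(2) True by (auto simp: lexpos_row_def)
  have "0 < u (Some (min i j)) + w (Some (min i j))"
    using i j by (cases i j rule: linorder_cases) (auto simp: min_def)
  moreover have "\<forall>m<min i j. u (Some m) + w (Some m) = 0" using i j by auto
  ultimately show ?thesis using True by (auto simp: lexpos_row_def)
next
  case False
  then show ?thesis using assms by (auto simp: lexpos_row_def)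
qed

lemma lexpos_row_scale:
  assumes "lexpos_row u" "0 < a"
  shows "lexpos_row (\<lambda>r. a * u r)"
  using assms by (auto simp: lexpos_row_def zero_less_mult_iff)

lemma lexpos_row_asym:
  assumes "lexpos_row u"
  shows "\<not> lexpos_row (\<lambda>r. - u r)"
proof
  assume "lexpos_row (\<lambda>r. - u r)"
  from lexpos_row_add[OF assms this] show False by (auto simp: lexpos_row_def)
qed

lemma lexpos_row_trichotomy:
  fixes u :: "'n::{finite,linorder} option \<Rightarrow> real"
  assumes "u r \<noteq> 0"
  shows "lexpos_row u \<or> lexpos_row (\<lambda>r. - u r)"
proof (cases "u None = 0")
  case True
  define S where "S = {i. u (Some i) \<noteq> 0}"
  have "S \<noteq> {}" using assms True by (cases r) (auto simp: S_def)
  then have "Min S \<in> S" by simp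
  moreover have "j \<notin> S" if "j < Min S" for j using that Min_le[of S j] by (metis finite leD)
  ultimately obtain i where i: "u (Some i) \<noteq> 0" "\<forall>j<i. u (Some j) = 0"
    unfolding S_def by blast
  then have "0 < u (Some i) \<or> 0 < - u (Some i)" by auto
  with i True show ?thesis by (auto simp: lexpos_row_def)
qed (auto simp: lexpos_row_def)

lemma lexpos_row_least:
  fixes f :: "'v \<Rightarrow> 'n::linorder option \<Rightarrow> real"
  assumes "finite S" "S \<noteq> {}"
  shows "\<exists>x\<in>S. \<forall>y\<in>S. \<not> lexpos_row (\<lambda>r. f x r - f y r)"
  using assms
proof (induction rule: finite_ne_induct)
  case (singleton x)
  then show ?case by (auto simp: lexpos_row_def)
next
  case (insert x S)
  then obtain m where m: "m \<in> S" "\<And>y. y \<in> S \<Longrightarrow> \<not> lexpos_row (\<lambda>r. f m r - f y r)" by auto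
  show ?case
  proof (cases "lexpos_row (\<lambda>r. f m r - f x r)")
    case True
    have "\<not> lexpos_row (\<lambda>r. f x r - f y r)" if "y \<in> S" for y
      using lexpos_row_add[OF True, of "\<lambda>r. f x r - f y r"] m(2)[OF that] by auto
    then show ?thesis by (auto simp: lexpos_row_def)
  next
    case False
    then show ?thesis using m by blast
  qed
qed

text \<open>Completeness indexes the columns of the label matrix by vertices. A bijection from the
  row indices onto \<open>B\<close> reduces the claim to square matrices, where one-sided inverses
  are two-sided.\<close>

lemma right_inverse_imp_left_inverse:
  fixes A W :: "'v \<Rightarrow> 'r::finite \<Rightarrow> real"
  assumes card: "finite B" "card B = CARD('r)"
    and inv: "\<And>r c. (\<Sum>y\<in>B. A y r * W y c) = (if r = c then 1 else 0)"
    and xy: "x \<in> B" "y \<in> B"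
  shows "(\<Sum>r\<in>UNIV. W x r * A y r) = (if x = y then 1 else 0)"
proof -
  obtain b :: "'r \<Rightarrow> 'v" where b: "bij_betw b UNIV B"
    using finite_same_card_bij[of "UNIV :: 'r set" B] card by auto
  define M :: "real^'r^'r" where "M = (\<chi> r c. A (b c) r)"
  define M' :: "real^'r^'r" where "M' = (\<chi> r c. W (b r) c)"
  have "(\<Sum>k\<in>UNIV. A (b k) r * W (b k) c) = (if r = c then 1 else 0)" for r c
    using sum.reindex_bij_betw[OF b, of "\<lambda>y. A y r * W y c"] inv by simp
  then have "M ** M' = mat 1"
    by (simp add: M_def M'_def matrix_matrix_mult_def mat_def vec_eq_iff)
  then have MM: "M' ** M = mat 1" by (simp add: matrix_left_right_inverse)
  obtain i j where ij: "x = b i" "y = b j" using b xy by (auto simp: bij_betw_def)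
  have "(\<Sum>r\<in>UNIV. W (b i) r * A (b j) r) = (M' ** M) $ i $ j"
    by (simp add: M_def M'_def matrix_matrix_mult_def)
  also have "\<dots> = (if i = j then 1 else 0)" using MM by (simp add: mat_def)
  finally show ?thesis using ij b by (auto simp: bij_betw_def inj_eq)
qed

lemma independent_imp_right_inverse:
  fixes A :: "'v \<Rightarrow> 'r::finite \<Rightarrow> real"
  assumes card: "finite B" "card B = CARD('r)"
    and ker: "\<And>u. (\<And>r. (\<Sum>y\<in>B. A y r * u y) = 0) \<Longrightarrow> \<forall>y\<in>B. u y = 0"
  shows "\<exists>W. \<forall>r c. (\<Sum>y\<in>B. A y r * W y c) = (if r = c then 1 else 0)"
proof -
  obtain b :: "'r \<Rightarrow> 'v" where b: "bij_betw b UNIV B"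
    using finite_same_card_bij[of "UNIV :: 'r set" B] card by auto
  define M :: "real^'r^'r" where "M = (\<chi> r c. A (b c) r)"
  have inv: "inv b (b i) = i" for i using b by (simp add: bij_betw_def)
  have re: "(\<Sum>y\<in>B. A y r * u (inv b y)) = (\<Sum>k\<in>UNIV. A (b k) r * u k)" for r and u :: "'r \<Rightarrow> real"
    using sum.reindex_bij_betw[OF b, of "\<lambda>y. A y r * u (inv b y)"] inv by simp
  have "x = 0" if "M *v x = 0" for x
  proof -
    have "(\<Sum>y\<in>B. A y r * x $ (inv b y)) = 0" for r
      using that re[of r "\<lambda>k. x $ k"] by (auto simp: M_def matrix_vector_mult_def vec_eq_iff)
    from ker[OF this] have "x $ k = 0" for k using b inv by (metis UNIV_I bij_betwE)
    then show "x = 0" by (simp add: vec_eq_iff)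
  qed
  then obtain M' where "M' ** M = mat 1" using matrix_left_invertible_ker by blast
  then have MM: "M ** M' = mat 1" by (simp add: matrix_left_right_inverse)
  have "(\<Sum>y\<in>B. A y r * M' $ (inv b y) $ c) = (M ** M') $ r $ c" for r c
    using re[of r "\<lambda>k. M' $ k $ c"] by (simp add: M_def matrix_matrix_mult_def)
  then show ?thesis using MM by (intro exI[of _ "\<lambda>y c. M' $ (inv b y) $ c"]) (simp add: mat_def)
qed

lemma complete_imp_weights:
  assumes "complete lab F"
  obtains u where "\<And>y. y \<in> F \<Longrightarrow> 0 \<le> u y"
    "\<And>r. (\<Sum>y\<in>F. Lentry lab y r * u y) = (if r = None then 1 else 0)"
proof -
  obtain W where W: "\<And>y. y \<in> F \<Longrightarrow> lexpos_row (W y)"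
    and LW: "\<And>r c. (\<Sum>y\<in>F. Lentry lab y r * W y c) = (if r = c then 1 else 0)"
    using assms unfolding complete_def by blast
  show thesis
  proof (rule that)
    show "0 \<le> W y None" if "y \<in> F" for y using W[OF that] by (auto simp: lexpos_row_def)
  qed (rule LW[of _ None])
qed

text \<open>The exchange step of lexicographic linear programming. A vertex can leave precisely when
  it attains the lexicographic minimum of the row ratios, and this minimum is attained only once,
  even if the first entries of several rows vanish.\<close>

lemma other_complete_facet:
  fixes lab :: "(((real, 'n::{finite,linorder}) vec) \<times> real \<Rightarrow> (real, 'n) vec)"
  assumes fin: "finite V" and card: "card V = Suc CARD('n option)"
    and y: "y \<in> V" and cpl: "complete lab (V - {y})"
  shows "\<exists>!y'. y' \<in> V \<and> y' \<noteq> y \<and> complete lab (V - {y'})"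
proof -
  let ?L = "Lentry lab" and ?B = "V - {y}"
  obtain W where W: "\<And>x. x \<in> ?B \<Longrightarrow> lexpos_row (W x)"
    and LW: "\<And>r c. (\<Sum>x\<in>?B. ?L x r * W x c) = (if r = c then 1 else 0)"
    using cpl unfolding complete_def by blast
  have B: "finite ?B" "card ?B = CARD('n option)" using fin card y by auto
  have WL: "(\<Sum>r\<in>UNIV. W x r * ?L w r) = (if x = w then 1 else 0)" if "x \<in> ?B" "w \<in> ?B" for x w
    using right_inverse_imp_left_inverse[of ?B ?L W x w, OF B LW that] .
  \<comment> \<open>\<open>\<alpha>\<close> expresses the entering column in the current basis; the leaving row must minimise
    \<open>W x / \<alpha> x\<close> lexicographically over \<open>\<alpha> x > 0\<close>.\<close>
  define \<alpha> where "\<alpha> x = (\<Sum>r\<in>UNIV. W x r * ?L y r)" for x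
  have comb: "(\<Sum>x\<in>?B. ?L x r * \<alpha> x) = ?L y r" for r
  proof -
    have "(\<Sum>x\<in>?B. ?L x r * \<alpha> x) = (\<Sum>x\<in>?B. \<Sum>c\<in>UNIV. ?L x r * W x c * ?L y c)"
      by (simp add: \<alpha>_def sum_distrib_left mult.assoc)
    also have "\<dots> = (\<Sum>c\<in>UNIV. (\<Sum>x\<in>?B. ?L x r * W x c) * ?L y c)"
      by (subst sum.swap) (simp add: sum_distrib_right)
    also have "\<dots> = ?L y r" by (simp add: LW if_distrib[of "\<lambda>a. a * _"] cong: if_cong)
    finally show ?thesis .
  qed
  \<comment> \<open>The label columns of \<open>V\<close> have a one-dimensional kernel, so a kernel
    vector is determined by its entry at \<open>y\<close>.\<close>
  have ker: "u x = - u y * \<alpha> x" if u: "\<And>r. (\<Sum>x\<in>V. ?L x r * u x) = 0" and x: "x \<in> ?B" for u x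
  proof -
    have uB: "(\<Sum>w\<in>?B. ?L w r * u w) = - u y * ?L y r" for r
      using u[of r] by (simp add: sum.remove[OF fin y] mult.commute)
    have eq: "(\<Sum>w\<in>?B. ?L w r * (u w + u y * \<alpha> w)) = 0" for r
    proof -
      have "(\<Sum>w\<in>?B. ?L w r * (u w + u y * \<alpha> w)) = (\<Sum>w\<in>?B. ?L w r * u w) + u y * (\<Sum>w\<in>?B. ?L w r * \<alpha> w)"
        by (simp add: distrib_left sum.distrib sum_distrib_left mult.left_commute)
      then show ?thesis using comb[of r] uB[of r] by simp
    qed
    have "0 = (\<Sum>r\<in>UNIV. W x r * (\<Sum>w\<in>?B. ?L w r * (u w + u y * \<alpha> w)))" by (simp add: eq)
    also have "\<dots> = (\<Sum>w\<in>?B. (\<Sum>r\<in>UNIV. W x r * ?L w r) * (u w + u y * \<alpha> w))"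
      by (simp only: sum_distrib_left sum_distrib_right mult.assoc) (rule sum.swap)
    also have "\<dots> = u x + u y * \<alpha> x"
      using x B by (simp add: WL if_distrib[of "\<lambda>a. a * _"] cong: if_cong)
    finally show ?thesis by simp
  qed
  \<comment> \<open>The row of ones in the label matrix guarantees a positive pivot, so the exchange
    can never be unbounded.\<close>
  have "(\<Sum>x\<in>?B. \<alpha> x) = 1" using comb[of None] by (simp add: Lentry_def)
  then have "\<exists>x\<in>?B. 0 < \<alpha> x" by (metis not_less sum_nonpos zero_less_one)
  then have S: "finite {x\<in>?B. 0 < \<alpha> x}" "{x\<in>?B. 0 < \<alpha> x} \<noteq> {}" using fin by auto
  obtain m where m: "m \<in> ?B" "0 < \<alpha> m"
    and least: "\<And>x. x \<in> ?B \<Longrightarrow> 0 < \<alpha> x \<Longrightarrow> \<not> lexpos_row (\<lambda>r. W m r / \<alpha> m - W x r / \<alpha> x)"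
    using lexpos_row_least[OF S, of "\<lambda>x r. W x r / \<alpha> x"] by auto
  \<comment> \<open>A tie would make two rows of \<open>W\<close> proportional, which is impossible
    for rows of an inverse matrix.\<close>
  have less: "lexpos_row (\<lambda>r. W x r / \<alpha> x - W m r / \<alpha> m)" if x: "x \<in> ?B" "0 < \<alpha> x" "x \<noteq> m" for x
  proof -
    obtain r where r: "W x r / \<alpha> x - W m r / \<alpha> m \<noteq> 0"
    proof (rule ccontr)
      assume "\<not> thesis"
      then have "W x r / \<alpha> x - W m r / \<alpha> m = 0" for r using that by blast
      then have "W x r = \<alpha> x / \<alpha> m * W m r" for r using x m by (simp add: field_simps)
      then have "(\<Sum>r\<in>UNIV. W x r * ?L x r) = \<alpha> x / \<alpha> m * (\<Sum>r\<in>UNIV. W m r * ?L x r)"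
        by (simp add: sum_distrib_left mult.assoc)
      then show False using WL[of x x] WL[of m x] x m by simp
    qed
    then show ?thesis
      using lexpos_row_trichotomy[of "\<lambda>r. W x r / \<alpha> x - W m r / \<alpha> m", OF r] least[OF x(1,2)]
      by simp
  qed
  show ?thesis
  proof (rule ex1I[of _ m])
    \<comment> \<open>The Gauss-Jordan update of the inverse. Its row at \<open>m\<close> is zero,
      so the sum over \<open>V - {m}\<close> may be taken over all of \<open>V\<close>.\<close>
    define W' where "W' x = (if x = y then (\<lambda>r. 1 / \<alpha> m * W m r) else (\<lambda>r. W x r - \<alpha> x / \<alpha> m * W m r))" for x
    have pos: "lexpos_row (W' x)" if x: "x \<in> V - {m}" for x
    proof (cases "x = y")
      case True
      then show ?thesis using lexpos_row_scale[OF W[OF m(1)], of "1 / \<alpha> m"] m by (simp add: W'_def)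
    next
      case False
      then have xB: "x \<in> ?B" using x by auto
      consider "\<alpha> x = 0" | "\<alpha> x < 0" | "0 < \<alpha> x" by linarith
      then show ?thesis
      proof cases
        case 1
        then show ?thesis using False W[OF xB] by (simp add: W'_def)
      next
        case 2
        have "lexpos_row (\<lambda>r. - \<alpha> x / \<alpha> m * W m r)"
        proof (rule lexpos_row_scale[OF W[OF m(1)]])
          show "0 < - \<alpha> x / \<alpha> m" using 2 m by (simp add: divide_neg_pos)
        qed
        from lexpos_row_add[OF W[OF xB] this] show ?thesis using False by (simp add: W'_def)
      next
        case 3
        have "lexpos_row (\<lambda>r. \<alpha> x * (W x r / \<alpha> x - W m r / \<alpha> m))"
          using lexpos_row_scale[OF less[OF xB 3] 3] x by simp
        moreover have "W' x = (\<lambda>r. \<alpha> x * (W x r / \<alpha> x - W m r / \<alpha> m))"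
          using False 3 by (simp add: W'_def right_diff_distrib)
        ultimately show ?thesis by simp
      qed
    qed
    have "(\<Sum>x\<in>V-{m}. ?L x r * W' x c) = (if r = c then 1 else 0)" for r c
    proof -
      have "W' m c = 0" using m by (auto simp: W'_def)
      then have "(\<Sum>x\<in>V-{m}. ?L x r * W' x c) = (\<Sum>x\<in>V. ?L x r * W' x c)"
        using sum.remove[of V m "\<lambda>x. ?L x r * W' x c"] fin m by auto
      also have "\<dots> = ?L y r * W' y c + (\<Sum>x\<in>?B. ?L x r * W' x c)"
        by (simp add: sum.remove[OF fin y])
      also have "(\<Sum>x\<in>?B. ?L x r * W' x c) = (\<Sum>x\<in>?B. ?L x r * W x c - ?L x r * \<alpha> x * (W m c / \<alpha> m))"
        by (rule sum.cong) (auto simp: W'_def algebra_simps)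
      also have "\<dots> = (if r = c then 1 else 0) - ?L y r * (W m c / \<alpha> m)"
        by (simp only: sum_subtractf LW comb flip: sum_distrib_right)
      finally show ?thesis by (simp add: W'_def)
    qed
    then show "m \<in> V \<and> m \<noteq> y \<and> complete lab (V - {m})" using m pos unfolding complete_def by blast
  next
    \<comment> \<open>The inverse belonging to another complete facet, extended by zero, differs
      from \<open>W\<close> by a kernel vector in each column. Its row at \<open>y\<close> is then
      the witness \<open>q\<close>, equal to the ratio of row \<open>a\<close>; positivity of its
      other rows says that no other ratio is as small.\<close>
    have unq: "\<exists>q. lexpos_row q \<and> (\<forall>r. W a r = \<alpha> a * q r) \<and>
        (\<forall>x\<in>?B - {a}. lexpos_row (\<lambda>r. W x r - \<alpha> x * q r)) \<and> 0 < \<alpha> a"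
      if a: "a \<in> V" "a \<noteq> y" "complete lab (V - {a})" for a
    proof -
      obtain W' where W': "\<And>x. x \<in> V - {a} \<Longrightarrow> lexpos_row (W' x)"
        and LW': "\<And>r c. (\<Sum>x\<in>V-{a}. ?L x r * W' x c) = (if r = c then 1 else 0)"
        using a unfolding complete_def by blast
      define D where "D c x = (if x = a then 0 else W' x c) - (if x = y then 0 else W x c)" for c x
      have D0: "(\<Sum>x\<in>V. ?L x r * D c x) = 0" for r c
      proof -
        have "(\<Sum>x\<in>V. ?L x r * D c x) = (\<Sum>x\<in>V. ?L x r * (if x = a then 0 else W' x c))
            - (\<Sum>x\<in>V. ?L x r * (if x = y then 0 else W x c))"
          by (simp add: D_def right_diff_distrib sum_subtractf)
        also have "(\<Sum>x\<in>V. ?L x r * (if x = a then 0 else W' x c)) = (\<Sum>x\<in>V-{a}. ?L x r * W' x c)"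
          using fin a by (simp add: sum.remove[of V a])
        also have "(\<Sum>x\<in>V. ?L x r * (if x = y then 0 else W x c)) = (\<Sum>x\<in>?B. ?L x r * W x c)"
          using fin y by (simp add: sum.remove[of V y])
        finally show ?thesis by (simp add: LW LW')
      qed
      have eq: "D c x = - W' y c * \<alpha> x" if "x \<in> ?B" for x c
        using ker[of "D c" x, OF D0 that] a by (simp add: D_def)
      have Wa: "W a r = \<alpha> a * W' y r" for r using eq[of a r] a by (simp add: D_def mult.commute)
      have qpos: "lexpos_row (W' y)" using W' a y by auto
      have "0 < \<alpha> a"
      proof (rule ccontr)
        assume "\<not> ?thesis"
        then consider "\<alpha> a = 0" | "0 < - \<alpha> a" by linarith
        then show False
        proof cases
          case 1
          then have "W a = (\<lambda>_. 0)" using Wa by auto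
          then show False using W[of a] a by (auto simp: lexpos_row_def)
        next
          case 2
          from lexpos_row_scale[OF qpos 2] show False
            using lexpos_row_asym[of "W a"] W[of a] a Wa by auto
        qed
      qed
      moreover have "lexpos_row (\<lambda>r. W x r - \<alpha> x * W' y r)" if "x \<in> ?B - {a}" for x
      proof -
        have "W' x r = W x r - \<alpha> x * W' y r" for r using eq[of x r] that by (auto simp: D_def algebra_simps)
        then have "W' x = (\<lambda>r. W x r - \<alpha> x * W' y r)" by auto
        then show ?thesis using W'[of x] that by simp
      qed
      ultimately show ?thesis using qpos Wa by blast
    qed
    fix a assume a: "a \<in> V \<and> a \<noteq> y \<and> complete lab (V - {a})"
    obtain q where q: "\<And>r. W a r = \<alpha> a * q r" "\<And>x. x \<in> ?B - {a} \<Longrightarrow> lexpos_row (\<lambda>r. W x r - \<alpha> x * q r)" "0 < \<alpha> a"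
      using unq[of a] a by blast
    show "a = m"
    proof (rule ccontr)
      assume am: "a \<noteq> m"
      have aB: "a \<in> ?B" using a by auto
      have "lexpos_row (\<lambda>r. 1 / \<alpha> m * (W m r - \<alpha> m * q r))" using lexpos_row_scale[OF q(2), of m "1 / \<alpha> m"] m am by auto
      moreover have "(\<lambda>r. 1 / \<alpha> m * (W m r - \<alpha> m * q r)) = (\<lambda>r. W m r / \<alpha> m - W a r / \<alpha> a)"
        using m q by (auto simp: field_simps fun_eq_iff)
      ultimately show False using least[OF aB q(3)] by simp
    qed
  qed
qed

section \<open>Graphs of maximal degree two\<close>

lemma degree_two_component_is_path:
  fixes E :: "'a \<Rightarrow> 'a \<Rightarrow> bool"
  assumes fin: "finite {v. E\<^sup>*\<^sup>* s v}"
    and sym: "\<And>a b. E a b \<Longrightarrow> E b a" and irr: "\<And>a. \<not> E a a"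
    and deg2: "\<And>v a b w. E v a \<Longrightarrow> E v b \<Longrightarrow> E v w \<Longrightarrow> a = b \<or> a = w \<or> b = w"
    and deg1: "\<And>a b. E s a \<Longrightarrow> E s b \<Longrightarrow> a = b"
  shows "\<exists>p. p \<noteq> [] \<and> distinct p \<and> hd p = s \<and> set p = {v. E\<^sup>*\<^sup>* s v} \<and>
     (\<forall>a\<in>set p. \<forall>b\<in>set p. E a b \<longleftrightarrow>
        (\<exists>i. Suc i < length p \<and> ((a = p ! i \<and> b = p ! Suc i) \<or> (b = p ! i \<and> a = p ! Suc i))))"
proof -
  \<comment> \<open>A longest path from \<open>s\<close> already exhausts the component.\<close>
  define P where "P p \<longleftrightarrow> p \<noteq> [] \<and> distinct p \<and> hd p = s \<and> (\<forall>i. Suc i < length p \<longrightarrow> E (p ! i) (p ! Suc i))" for p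
  have reach: "E\<^sup>*\<^sup>* s (p ! i)" if "P p" "i < length p" for p i
    using that(2)
  proof (induction i)
    case 0
    then show ?case using that(1) by (simp add: P_def hd_conv_nth)
  next
    case (Suc i)
    then show ?case using that(1) by (auto simp: P_def intro: rtranclp.rtrancl_into_rtrancl)
  qed
  have sub: "set p \<subseteq> {v. E\<^sup>*\<^sup>* s v}" if "P p" for p
    using reach[OF that] by (auto simp: in_set_conv_nth)
  have len: "length p \<le> card {v. E\<^sup>*\<^sup>* s v}" if "P p" for p
    using card_mono[OF fin sub[OF that]] that by (auto simp: P_def distinct_card)
  have "P [s]" by (simp add: P_def)
  then obtain p where p: "P p" and mx: "\<And>q. P q \<Longrightarrow> length q \<le> length p"
    using ex_has_greatest_nat[of P "[s]" length "Suc (card {v. E\<^sup>*\<^sup>* s v})"] len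
    by (auto simp: le_imp_less_Suc)
  define n where "n = length p"
  have n0: "0 < n" and dis: "distinct p" and p0: "p ! 0 = s"
    and step: "\<And>i. Suc i < n \<Longrightarrow> E (p ! i) (p ! Suc i)"
    using p by (auto simp: P_def n_def hd_conv_nth)
  have step': "E (p ! Suc i) (p ! i)" if "Suc i < n" for i
    using step[OF that] sym by blast
  have inj: "p ! i = p ! j \<longleftrightarrow> i = j" if "i < n" "j < n" for i j
    using dis that by (simp add: n_def nth_eq_iff_index_eq)
  have lastE: "b \<in> set p" if "E (p ! (n - 1)) b" for b
  proof (rule ccontr)
    assume b: "b \<notin> set p"
    have "P (p @ [b])"
      unfolding P_def
    proof (intro conjI allI impI)
      show "hd (p @ [b]) = s" using p by (auto simp: P_def)
      show "distinct (p @ [b])" using dis b by simp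
      fix i assume "Suc i < length (p @ [b])"
      then have "Suc i < n \<or> Suc i = n" by (simp add: n_def) linarith
      then consider "Suc i < n" | "Suc i = n" by blast
      then show "E ((p @ [b]) ! i) ((p @ [b]) ! Suc i)"
      proof cases
        case 1
        then show ?thesis using step by (simp add: nth_append n_def)
      next
        case 2
        then have "i = n - 1" by simp
        then have "p ! i = p ! (n - 1)" by simp
        then show ?thesis using that 2 by (simp add: nth_append n_def)
      qed
    qed auto
    from mx[OF this] show False by simp
  qed
  have nb: "b \<in> set p \<and> (\<exists>j<n. b = p ! j \<and> (j = Suc i \<or> i = Suc j))" if i: "i < n" and E: "E (p ! i) b" for i b
  proof -
    consider "i = 0" "Suc i < n" | j where "i = Suc j" "Suc i < n" | "i = n - 1"
    proof -
      have "i = n - 1 \<or> Suc i < n" using i by linarith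
      then show thesis using that by (cases i) auto
    qed
    then show ?thesis
    proof cases
      case 1
      then have "b = p ! Suc 0" using deg1 step[of 0] E p0 by auto
      then show ?thesis using 1 by (auto simp: n_def)
    next
      case 2
      have "p ! j \<noteq> p ! Suc i" using inj 2 by auto
      moreover have "E (p ! i) (p ! j)" "E (p ! i) (p ! Suc i)" using step step' 2 by auto
      ultimately have "b = p ! j \<or> b = p ! Suc i" using deg2[OF E] by blast
      then show ?thesis using 2 Suc_lessD[OF 2(2)] by (metis Suc_lessD n_def nth_mem)
    next
      case 3
      then have bp: "b \<in> set p" using lastE E by auto
      then obtain j where j: "j < n" "b = p ! j" by (auto simp: in_set_conv_nth n_def)
      have Eb: "E (p ! j) (p ! i)" using E j sym by auto
      \<comment> \<open>An edge from the last vertex back to an earlier \<open>p ! j\<close> would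
        exceed the degree bound there: a second neighbour at \<open>s\<close>, a third one
        elsewhere.\<close>
      have "i = Suc j"
      proof (rule ccontr)
        assume ne: "i \<noteq> Suc j"
        have "j \<noteq> i" using irr E j by auto
        then have ji: "Suc j < i" using ne j 3 by auto
        have E1: "E (p ! j) (p ! Suc j)" using step ji i by auto
        show False
        proof (cases j)
          case 0
          then have "p ! i = p ! Suc j" using deg1 Eb E1 p0 by auto
          then show False using inj ji i by auto
        next
          case (Suc m)
          then have "E (p ! j) (p ! m)" using step' ji i by auto
          from deg2[OF this E1 Eb] show False using inj ji i Suc by auto
        qed
      qed
      then show ?thesis using j bp by auto
    qed
  qed
  have "{v. E\<^sup>*\<^sup>* s v} \<subseteq> set p"
  proof
    fix v assume "v \<in> {v. E\<^sup>*\<^sup>* s v}"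
    then have "E\<^sup>*\<^sup>* s v" by simp
    then show "v \<in> set p"
    proof (induction rule: rtranclp_induct)
      case base
      then show ?case using p0 n0 by (metis n_def nth_mem)
    next
      case (step y z)
      then show ?case using nb by (metis in_set_conv_nth n_def)
    qed
  qed
  then have "set p = {v. E\<^sup>*\<^sup>* s v}" using sub[OF p] by blast
  moreover have "E a b \<longleftrightarrow>
        (\<exists>i. Suc i < length p \<and> ((a = p ! i \<and> b = p ! Suc i) \<or> (b = p ! i \<and> a = p ! Suc i)))"
    if ab: "a \<in> set p" "b \<in> set p" for a b
  proof
    assume E: "E a b"
    obtain i where i: "i < n" "a = p ! i" using ab by (auto simp: in_set_conv_nth n_def)
    obtain j where "j < n" "b = p ! j" "j = Suc i \<or> i = Suc j" using nb[of i b] i E by auto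
    then show "\<exists>i. Suc i < length p \<and> ((a = p ! i \<and> b = p ! Suc i) \<or> (b = p ! i \<and> a = p ! Suc i))"
      using i by (auto simp: n_def)
  next
    assume "\<exists>i. Suc i < length p \<and> ((a = p ! i \<and> b = p ! Suc i) \<or> (b = p ! i \<and> a = p ! Suc i))"
    then show "E a b" using step step' by (auto simp: n_def)
  qed
  ultimately show ?thesis using p by (intro exI[of _ p]) (simp add: P_def)
qed

section \<open>Monotone aggregation and the homotopy\<close>

text \<open>The definition gives monotonicity only when every coordinate increases strictly. Adding
  a small multiple of \<open>onevec\<close> to \<open>t\<close> reaches that case, and continuity
  removes the perturbation.\<close>

lemma MAF_mono:
  fixes m :: "real^'n \<Rightarrow> real"
  assumes m: "MAF m" and s: "s \<in> nonneg_orthant" and t: "t \<in> nonneg_orthant"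
    and le: "\<And>i. s $ i \<le> t $ i"
  shows "m s \<le> m t"
proof -
  let ?t = "\<lambda>n::nat. t + (1 / Suc n) *\<^sub>R onevec"
  have pos: "0 < 1 / real (Suc n)" for n by simp
  have tn: "?t n \<in> nonneg_orthant" for n
    using t pos[of n] by (auto simp: nonneg_orthant_def onevec_def simp del: of_nat_Suc)
  have "s $ i < ?t n $ i" for n i
    using add_le_less_mono[OF le[of i] pos[of n]] by (simp add: onevec_def)
  then have lt: "m s < m (?t n)" for n
    using m s tn unfolding MAF_def by blast
  have "(\<lambda>n. 1 / real (Suc n)) \<longlonglongrightarrow> 0" using LIMSEQ_Suc[OF lim_1_over_n] .
  then have "?t \<longlonglongrightarrow> t + 0 *\<^sub>R onevec"
    by (intro tendsto_intros)
  then have "?t \<longlonglongrightarrow> t" by simp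
  then have "(\<lambda>n. m (?t n)) \<longlonglongrightarrow> m t"
    using m t tn unfolding MAF_def
    by (intro continuous_on_tendsto_compose[of nonneg_orthant m]) auto
  then show ?thesis
  proof (rule LIMSEQ_le_const, intro exI allI impI)
    show "m s \<le> m (?t n)" for n by (rule less_imp_le[OF lt])
  qed
qed

lemma gain_mono:
  assumes "Kinf h \<or> zero_fun_R h" "0 \<le> x" "x \<le> y"
  shows "h x \<le> h y"
  using assms by (cases "x = y") (auto simp: Kinf_def zero_fun_R_def strict_mono_on_def intro: less_imp_le)

lemma gain_zero:
  assumes "Kinf h \<or> zero_fun_R h"
  shows "h 0 = 0"
  using assms by (auto simp: Kinf_def zero_fun_R_def)

lemma gain_continuous:
  assumes "Kinf h \<or> zero_fun_R h"
  shows "continuous_on {0..} h"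
  using assms
proof
  assume "zero_fun_R h"
  then have "continuous_on {0..} h \<longleftrightarrow> continuous_on {0::real..} (\<lambda>_. 0::real)"
    by (intro continuous_on_cong) (auto simp: zero_fun_R_def)
  then show ?thesis by simp
qed (simp add: Kinf_def)

lemma component_le_norm_diff:
  fixes x y :: "real^'n"
  assumes "0 \<le> d" "\<And>i. \<bar>x $ i - y $ i\<bar> \<le> d"
  shows "norm (x - y) \<le> d * sqrt (real CARD('n))"
proof -
  have "norm (x - y) \<le> norm (d *\<^sub>R onevec :: real^'n)"
    using assms by (intro norm_le_componentwise_cart) (simp add: onevec_def)
  also have "norm (d *\<^sub>R onevec :: real^'n) = d * sqrt (real CARD('n))"
    using assms(1) by (simp add: onevec_def norm_vec_def L2_set_def real_sqrt_mult)
  finally show ?thesis .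
qed

text \<open>Used with \<open>a = kG\<close>, \<open>b = k0\<close> and q = (kG + 2 k0)/(2k): the far
  shell lies beyond kG/2, the radius at which the damping in \<open>phi_map\<close> starts.\<close>

lemma half_less_if_gap: "q \<le> (a + 2 * b) / 2 \<Longrightarrow> a + b - q < n \<Longrightarrow> a / 2 < (n::real)"
  by (simp add: field_simps)

text \<open>First column of the matrix \<open>W\<close> in the definition of completeness.\<close>
definition weights :: "((real^'n) \<times> real \<Rightarrow> real^'n) \<Rightarrow> ((real^'n) \<times> real) set \<Rightarrow> ((real^'n) \<times> real \<Rightarrow> real) \<Rightarrow> bool" where
  "weights lab F u \<longleftrightarrow> (\<forall>y\<in>F. 0 \<le> u y) \<and>
     (\<forall>r. (\<Sum>y\<in>F. Lentry lab y r * u y) = (if r = None then 1 else 0))"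

lemma weights_label:
  assumes "weights (label c f) F u"
  shows "\<And>y. y \<in> F \<Longrightarrow> 0 \<le> u y" "(\<Sum>y\<in>F. u y) = 1"
    "(\<Sum>y\<in>F. u y * ((1 - snd y) * c $ i + snd y * f (fst y) $ i)) = (\<Sum>y\<in>F. u y * fst y $ i)"
proof -
  show "0 \<le> u y" if "y \<in> F" for y using assms that by (simp add: weights_def)
  have "(\<Sum>y\<in>F. Lentry (label c f) y None * u y) = 1" using assms unfolding weights_def by simp
  then show "(\<Sum>y\<in>F. u y) = 1" by (simp add: Lentry_def)
  have "(\<Sum>y\<in>F. u y * ((1 - snd y) * c $ i + snd y * f (fst y) $ i)) - (\<Sum>y\<in>F. u y * fst y $ i)
      = (\<Sum>y\<in>F. Lentry (label c f) y (Some i) * u y)"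
    unfolding sum_subtractf[symmetric]
    by (rule sum.cong) (simp_all add: Lentry_def label_def algebra_simps)
  also have "\<dots> = 0" using assms unfolding weights_def by simp
  finally show "(\<Sum>y\<in>F. u y * ((1 - snd y) * c $ i + snd y * f (fst y) $ i)) = (\<Sum>y\<in>F. u y * fst y $ i)"
    by simp
qed

lemma weighted_mean_near:
  fixes F :: "'a set" and u :: "'a \<Rightarrow> real" and p :: "'a \<Rightarrow> real"
  assumes u: "\<And>y. y \<in> F \<Longrightarrow> 0 \<le> u y" "(\<Sum>y\<in>F. u y) = 1"
    and near: "\<And>y. y \<in> F \<Longrightarrow> \<bar>p y - a\<bar> \<le> d"
  shows "\<bar>(\<Sum>y\<in>F. u y * p y) - a\<bar> \<le> d"
proof -
  have "(\<Sum>y\<in>F. u y * p y) - a = (\<Sum>y\<in>F. u y * (p y - a))"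
    using u(2) by (simp add: right_diff_distrib sum_subtractf flip: sum_distrib_right)
  also have "\<bar>\<dots>\<bar> \<le> (\<Sum>y\<in>F. u y * d)"
    using u(1) near by (intro order.trans[OF sum_abs] sum_mono) (simp add: abs_mult mult_left_mono)
  also have "\<dots> = d" using u(2) by (simp flip: sum_distrib_right)
  finally show ?thesis .
qed

section \<open>Estimates for the damped map and its approximate fixed points\<close>

locale gain_network =
  fixes g :: "'n::finite \<Rightarrow> 'n \<Rightarrow> real \<Rightarrow> real" and mu :: "'n \<Rightarrow> real^'n \<Rightarrow> real"
    and k0 kG kh :: real
  assumes gains: "Kinf (g i j) \<or> zero_fun_R (g i j)"
    and irred: "irreducible_gain g"
    and maf: "MAF (mu i)"
    and sgc: "s \<in> nonneg_orthant \<Longrightarrow> s \<noteq> 0 \<Longrightarrow> \<exists>i. Gamma_mu mu g s $ i < s $ i"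
    and k0: "0 < k0" and kh: "0 < kh" and khG: "kh < kG"
begin

abbreviation "\<Gamma> \<equiv> Gamma_mu mu g"
abbreviation "\<phi> \<equiv> phi_map k0 kG kh mu g"

definition factor :: "real^'n \<Rightarrow> real" where
  "factor v = 1 + min 0 ((kG - 2 * norm v) / (norm v + k0))"

lemma phi_component: "\<phi> v $ i = factor v * \<Gamma> v $ i + max 0 (kh - 2 * norm v)"
  by (simp add: phi_map_def factor_def onevec_def)

lemma gains_orthant: "s \<in> nonneg_orthant \<Longrightarrow> (\<chi> j. g i j (s $ j)) \<in> nonneg_orthant"
  using gain_mono[OF gains, of 0] gain_zero[OF gains] by (fastforce simp: nonneg_orthant_def)

lemma Gamma_nonneg: "s \<in> nonneg_orthant \<Longrightarrow> 0 \<le> \<Gamma> s $ i"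
  using maf[of i] gains_orthant[of s i] by (simp add: Gamma_mu_def MAF_def)

lemma Gamma_mono:
  assumes "s \<in> nonneg_orthant" "t \<in> nonneg_orthant" "\<And>i. s $ i \<le> t $ i"
  shows "\<Gamma> s $ i \<le> \<Gamma> t $ i"
proof -
  have "g i j (s $ j) \<le> g i j (t $ j)" for j
    using assms by (intro gain_mono[OF gains]) (auto simp: nonneg_orthant_def)
  then have "mu i (\<chi> j. g i j (s $ j)) \<le> mu i (\<chi> j. g i j (t $ j))"
    by (intro MAF_mono[OF maf] gains_orthant assms(1,2)) simp
  then show ?thesis by (simp add: Gamma_mu_def)
qed

lemma Gamma_pos:
  assumes s: "s \<in> nonneg_orthant" and b: "\<not> zero_fun_R (g a b)" "0 < s $ b"
  shows "0 < \<Gamma> s $ a"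
proof -
  have "Kinf (g a b)" using gains b(1) by blast
  then have "0 < g a b (s $ b)" 
    using b(2) strict_mono_onD[of "{0..}" "g a b" 0 "s $ b"] by (simp add: Kinf_def)
  then have "(\<chi> j. g a j (s $ j)) \<noteq> 0" by (auto simp: vec_eq_iff intro!: exI[of _ b])
  then have "\<Gamma> s $ a \<noteq> 0"
    using maf[of a] gains_orthant[OF s, of a] unfolding Gamma_mu_def MAF_def by simp
  then show ?thesis using Gamma_nonneg[OF s, of a] by simp
qed

lemma Gamma_continuous: "continuous_on nonneg_orthant \<Gamma>"
  unfolding Gamma_mu_def
proof (rule continuous_on_vec_lambda)
  fix i
  have "continuous_on nonneg_orthant (\<lambda>s. g i j (s $ j))" for j
    by (rule continuous_on_compose2[OF gain_continuous[OF gains]])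
       (auto intro!: continuous_intros simp: nonneg_orthant_def)
  then have "continuous_on nonneg_orthant (\<lambda>s. \<chi> j. g i j (s $ j))"
    by (rule continuous_on_vec_lambda)
  moreover have "continuous_on nonneg_orthant (mu i)" using maf by (simp add: MAF_def)
  ultimately show "continuous_on nonneg_orthant (\<lambda>s. mu i (\<chi> j. g i j (s $ j)))"
    using gains_orthant by (auto intro: continuous_on_compose2)
qed

lemma phi_continuous: "continuous_on nonneg_orthant \<phi>"
proof -
  have "norm v + k0 \<noteq> 0" for v :: "real^'n" using k0 norm_ge_zero[of v] by linarith
  then show ?thesis
    unfolding phi_map_def by (intro continuous_intros Gamma_continuous) auto
qed

text \<open>Once damping is active the factor is (kG + k0 - |v|)/(|v| + k0), which changes sign at
  kG + k0. This is the origin of the radius in all later bounds.\<close>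

lemma factor_pos: "norm v < kG + k0 \<Longrightarrow> 0 < factor v"
proof -
  assume n: "norm v < kG + k0"
  have "0 < norm v + k0" using k0 norm_ge_zero[of v] by linarith
  then have "(kG - 2 * norm v) / (norm v + k0) > -1" using n by (simp add: field_simps)
  then show ?thesis by (simp add: factor_def min_def)
qed

lemma factor_le: "factor v \<le> (kG + k0 - norm v) / (norm v + k0)"
proof -
  have "0 < norm v + k0" using k0 norm_ge_zero[of v] by linarith
  then have "1 + (kG - 2 * norm v) / (norm v + k0) = (kG + k0 - norm v) / (norm v + k0)"
    by (simp add: field_simps)
  then show ?thesis unfolding factor_def by linarith
qed

lemma phi_nonneg:
  assumes "v \<in> nonneg_orthant" "norm v < kG + k0"
  shows "0 \<le> \<phi> v $ i"
  unfolding phi_component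
  using factor_pos[OF assms(2)] Gamma_nonneg[OF assms(1)] by simp

lemma phi_eq_0D:
  assumes "v \<in> nonneg_orthant" "norm v < kG + k0" "\<phi> v $ i = 0"
  shows "\<Gamma> v $ i = 0" "kh \<le> 2 * norm v"
proof -
  have "0 \<le> factor v * \<Gamma> v $ i" using factor_pos[OF assms(2)] Gamma_nonneg[OF assms(1)] by simp
  moreover have "0 \<le> max 0 (kh - 2 * norm v)" by simp
  ultimately have "factor v * \<Gamma> v $ i = 0" "max 0 (kh - 2 * norm v) = 0"
    using assms(3) unfolding phi_component by linarith+
  then show "\<Gamma> v $ i = 0" "kh \<le> 2 * norm v"
    using factor_pos[OF assms(2)] by (auto simp: max_def split: if_splits)
qed

text \<open>Write q = (kG + 2 k0)/(2k). At norm kG + k0 - q the denominator of the factor is kG + 2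
  k0 - q = (2k - 1) q and the numerator is q, whence 1/(2k - 1). Beyond kG + k0 the factor is
  nonpositive; inside, \<open>v\<close> lies below (kG + k0) e and \<open>Gamma_mono\<close>
  applies.\<close>

lemma phi_upper:
  assumes v: "v \<in> nonneg_orthant" and k: "1 \<le> k"
    and n: "kG + k0 - (kG + 2 * k0) / (2 * real k) < norm v"
  shows "\<phi> v $ i \<le> (1 / (2 * real k - 1)) * \<Gamma> ((kG + k0) *\<^sub>R onevec) $ i"
proof -
  let ?G = "\<Gamma> ((kG + k0) *\<^sub>R onevec) $ i"
  have kr: "1 \<le> real k" using k by simp
  have e0: "((kG + k0) *\<^sub>R onevec :: real^'n) \<in> nonneg_orthant"
    using k0 kh khG by (simp add: nonneg_orthant_def onevec_def)
  have rhs: "0 \<le> (1 / (2 * real k - 1)) * ?G" using Gamma_nonneg[OF e0] kr by simp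
  have nk: "0 < norm v + k0" using k0 norm_ge_zero[of v] by linarith
  have "(kG + 2 * k0) / (2 * real k) \<le> (kG + 2 * k0) / 2"
    using kr k0 kh khG by (intro divide_left_mono) auto
  from half_less_if_gap[OF this n] have "kG / 2 < norm v" .
  then have phi: "\<phi> v $ i = factor v * \<Gamma> v $ i" using khG by (simp add: phi_component)
  show ?thesis
  proof (cases "norm v < kG + k0")
    case False
    then have "(kG + k0 - norm v) / (norm v + k0) \<le> 0" using nk by (simp add: divide_nonpos_pos)
    then have "factor v \<le> 0" using factor_le[of v] by linarith
    then have "\<phi> v $ i \<le> 0" unfolding phi using Gamma_nonneg[OF v] by (simp add: mult_nonpos_nonneg)
    then show ?thesis using rhs by linarith
  next
    case True
    have "\<Gamma> v $ i \<le> ?G"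
    proof (rule Gamma_mono[OF v e0])
      show "v $ j \<le> ((kG + k0) *\<^sub>R onevec) $ j" for j
        using component_le_norm_cart[of v j] True by (simp add: onevec_def)
    qed
    moreover have "factor v \<le> 1 / (2 * real k - 1)"
    proof -
      have "(2 * real k) * (kG + k0 - norm v) < kG + 2 * k0"
        using n kr by (simp add: field_simps)
      then have "(kG + k0 - norm v) * (2 * real k - 1) \<le> norm v + k0"
        by (simp add: algebra_simps)
      then have "(kG + k0 - norm v) / (norm v + k0) \<le> 1 / (2 * real k - 1)"
        using nk kr by (simp add: divide_le_eq le_divide_eq mult.commute)
      then show ?thesis using factor_le[of v] by linarith
    qed
    ultimately show ?thesis unfolding phi
      using Gamma_nonneg[OF v, of i] kr by (intro mult_mono) auto
  qed
qed

text \<open>The bound on \<open>d\<close> makes the Euclidean diameter of \<open>F\<close> smaller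
  than (kG + 2 k0)/(2k). One vertex of norm at least kG + k0 therefore pulls all vertices and their
  weighted mean \<open>x\<close> into the shell of \<open>phi_upper\<close>, so the estimate by
  \<open>c\<close> holds at every vertex simultaneously.\<close>

lemma weights_norm_bound:
  assumes w: "weights (label c \<phi>) F u"
    and F: "\<And>y. y \<in> F \<Longrightarrow> fst y \<in> nonneg_orthant" "\<And>y. y \<in> F \<Longrightarrow> snd y = 0 \<or> snd y = 1"
      "\<And>x y i. x \<in> F \<Longrightarrow> y \<in> F \<Longrightarrow> \<bar>fst x $ i - fst y $ i\<bar> \<le> d"
    and d: "0 < d" "d < (kG + 2 * k0) / (2 * real k * sqrt (real CARD('n)))" and k: "1 \<le> k"
    and cnorm: "norm c < kG / 2"
    and kmax: "\<And>i. (1 / (2 * real k - 1)) * \<Gamma> ((kG + k0) *\<^sub>R onevec) $ i < c $ i"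
    and y: "y \<in> F"
  shows "norm (fst y) < kG + k0"
proof (rule ccontr)
  assume "\<not> ?thesis"
  then have ny: "kG + k0 \<le> norm (fst y)" by simp
  have kr: "1 \<le> real k" using k by simp
  have N: "0 < sqrt (real CARD('n))" by simp
  have dN: "d * sqrt (real CARD('n)) < (kG + 2 * k0) / (2 * real k)"
    using d(2) N kr by (simp add: field_simps)
  have far: "kG + k0 - (kG + 2 * k0) / (2 * real k) < norm p"
    if "\<And>i. \<bar>p $ i - fst y $ i\<bar> \<le> d" for p
  proof -
    have "norm (p - fst y) < (kG + 2 * k0) / (2 * real k)"
      using component_le_norm_diff[of d p "fst y"] that d(1) dN by simp
    moreover have "norm (fst y) \<le> norm p + norm (p - fst y)"
      using norm_triangle_sub[of "fst y" p] by (simp add: norm_minus_commute)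
    ultimately show ?thesis using ny by linarith
  qed
  define x :: "real^'n" where "x = (\<chi> i. \<Sum>z\<in>F. u z * fst z $ i)"
  have "\<bar>x $ i - fst y $ i\<bar> \<le> d" for i
    unfolding x_def using weighted_mean_near[OF weights_label(1,2)[OF w], of "\<lambda>z. fst z $ i" "fst y $ i" d] F(3) y by simp
  then have "kG + k0 - (kG + 2 * k0) / (2 * real k) < norm x" by (rule far)
  moreover have "(kG + 2 * k0) / (2 * real k) \<le> (kG + 2 * k0) / 2"
    using kr k0 kh khG by (intro divide_left_mono) auto
  ultimately have nx: "kG / 2 < norm x" by (intro half_less_if_gap)
  have "0 \<le> x $ i" for i
    unfolding x_def using weights_label(1)[OF w] F(1) by (auto intro!: sum_nonneg simp: nonneg_orthant_def)
  moreover have "x $ i \<le> c $ i" for i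
  proof -
    have "u z * ((1 - snd z) * c $ i + snd z * \<phi> (fst z) $ i) \<le> u z * c $ i" if z: "z \<in> F" for z
    proof -
      have "\<phi> (fst z) $ i \<le> c $ i"
        using phi_upper[OF F(1)[OF z] k far] F(3)[OF z y] kmax[of i] by (meson less_imp_le order.trans)
      then have "(1 - snd z) * c $ i + snd z * \<phi> (fst z) $ i \<le> c $ i" using F(2)[OF z] by auto
      then show ?thesis using weights_label(1)[OF w z] by (rule mult_left_mono)
    qed
    then have "x $ i \<le> (\<Sum>z\<in>F. u z * c $ i)"
      unfolding x_def by (simp add: weights_label(3)[OF w, symmetric] sum_mono)
    also have "\<dots> = c $ i" using weights_label(2)[OF w] by (simp flip: sum_distrib_right)
    finally show ?thesis .
  qed
  ultimately have "norm (x $ i) \<le> norm (c $ i)" for i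
    by (metis abs_of_nonneg order.trans real_norm_def)
  then have "norm x \<le> norm c" by (rule norm_le_componentwise_cart)
  then show False using nx cnorm by linarith
qed

lemma weights_not_lateral:
  assumes w: "weights (label c \<phi>) F u" and fin: "finite F"
    and F: "\<And>y. y \<in> F \<Longrightarrow> fst y \<in> nonneg_orthant" "\<And>y. y \<in> F \<Longrightarrow> snd y = 0 \<or> snd y = 1"
      "\<And>y. y \<in> F \<Longrightarrow> norm (fst y) < kG + k0"
    and cpos: "\<And>i. 0 < c $ i"
  shows "\<not> (\<forall>y\<in>F. fst y $ l = 0)"
proof
  assume l: "\<forall>y\<in>F. fst y $ l = 0"
  \<comment> \<open>Vertices of weight zero say nothing about the mean, so the argument runs on the
    face \<open>S\<close> of positive weights, which may lie in further coordinate hyperplanes;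
    \<open>I\<close> collects all of them.\<close>
  define S where "S = {y\<in>F. 0 < u y}"
  define I where "I = {i. \<forall>y\<in>S. fst y $ i = 0}"
  have "\<exists>y\<in>F. 0 < u y"
    using weights_label(2)[OF w] by (metis not_less sum_nonpos zero_less_one)
  then obtain y0 where y0: "y0 \<in> S" by (auto simp: S_def)
  have key: "\<Gamma> (fst y) $ i = 0" "kh \<le> 2 * norm (fst y)" if i: "i \<in> I" and y: "y \<in> S" for i y
  proof -
    have nn: "0 \<le> (1 - snd z) * c $ i + snd z * \<phi> (fst z) $ i" if "z \<in> F" for z
      using F(2)[OF that] phi_nonneg[OF F(1)[OF that] F(3)[OF that]] cpos[of i] by auto
    have "(\<Sum>z\<in>F. u z * fst z $ i) = 0"
    proof (rule sum.neutral, rule ballI)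
      fix z assume z: "z \<in> F"
      show "u z * fst z $ i = 0"
      proof (cases "u z = 0")
        case False
        then have "z \<in> S" using weights_label(1)[OF w z] z by (simp add: S_def)
        then have "fst z $ i = 0" using i unfolding I_def by blast
        then show ?thesis by simp
      qed simp
    qed
    then have "(\<Sum>z\<in>F. u z * ((1 - snd z) * c $ i + snd z * \<phi> (fst z) $ i)) = 0"
      using weights_label(3)[OF w] by simp
    \<comment> \<open>Nonnegative terms with sum zero vanish one by one. At level 0 the bracket
      would be \<open>c $ i\<close>, which is positive, so every vertex of \<open>S\<close> is at
      level 1.\<close>
    then have "\<forall>z\<in>F. u z * ((1 - snd z) * c $ i + snd z * \<phi> (fst z) $ i) = 0"
      using fin nn weights_label(1)[OF w] by (subst (asm) sum_nonneg_eq_0_iff) auto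
    then have "(1 - snd y) * c $ i + snd y * \<phi> (fst y) $ i = 0" using y by (auto simp: S_def)
    then have "\<phi> (fst y) $ i = 0" using F(2)[of y] y cpos[of i] by (auto simp: S_def)
    then show "\<Gamma> (fst y) $ i = 0" "kh \<le> 2 * norm (fst y)"
      using phi_eq_0D[of "fst y" i] F y by (auto simp: S_def)
  qed
  have lI: "l \<in> I" using l by (auto simp: I_def S_def)
  \<comment> \<open>The summand max{0, kh - 2|v|} e of phi keeps the vertices of \<open>S\<close>
    away from the origin; hence \<open>I\<close> is a proper subset of the coordinates.\<close>
  have "fst y0 \<noteq> 0" using key(2)[OF lI y0] kh by auto
  then obtain m where m: "m \<notin> I" using y0 by (auto simp: vec_eq_iff I_def)
  have "(\<lambda>a b. \<not> zero_fun_R (g a b))\<^sup>+\<^sup>+ l m" using irred by (simp add: irreducible_gain_def)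
  \<comment> \<open>A path in the gain graph from \<open>l\<close> inside \<open>I\<close> to
    \<open>m\<close> outside must leave \<open>I\<close> along some edge.\<close>
  then have "\<exists>a b. a \<in> I \<and> b \<notin> I \<and> \<not> zero_fun_R (g a b)"
    using m
  proof (induction rule: tranclp_induct)
    case (base b)
    then show ?case using lI by blast
  next
    case (step b b')
    then show ?case by blast
  qed
  then obtain a b where ab: "a \<in> I" "b \<notin> I" "\<not> zero_fun_R (g a b)" by blast
  then obtain y where y: "y \<in> S" "fst y $ b \<noteq> 0" by (auto simp: I_def)
  have o: "fst y \<in> nonneg_orthant" using F(1) y by (simp add: S_def)
  then have "0 < fst y $ b" using y(2) by (simp add: nonneg_orthant_def less_le)
  from Gamma_pos[OF o ab(3) this] key(1)[OF ab(1) y(1)] show False by simp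
qed

text \<open>At level 1 the weights express the same point as a mean of the vertices and as a mean of
  their images under \<open>\<phi>\<close>. The vertices shrink to \<open>s\<close>, so by
  continuity the second mean tends to the value of \<open>\<phi>\<close> at \<open>s\<close>, while
  the first tends to \<open>s\<close>.\<close>

lemma approximate_fixed_points_limit:
  fixes s :: "real^'n"
  assumes w: "\<And>m. weights (label c \<phi>) (F m) (u m)"
    and F: "\<And>m y. y \<in> F m \<Longrightarrow> fst y \<in> nonneg_orthant" "\<And>m y. y \<in> F m \<Longrightarrow> snd y = 1"
      "\<And>m x y i. x \<in> F m \<Longrightarrow> y \<in> F m \<Longrightarrow> \<bar>fst x $ i - fst y $ i\<bar> \<le> d m"
      "\<And>m y. y \<in> F m \<Longrightarrow> norm (fst y) < kG + k0"
    and d: "d \<longlonglongrightarrow> 0" "\<And>m. 0 < d m"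
    and lim: "(\<lambda>m. \<Sum>y\<in>F m. u m y *\<^sub>R fst y) \<longlonglongrightarrow> s"
  shows "\<phi> s = s" "s \<in> nonneg_orthant" "norm s \<le> kG + k0"
proof -
  let ?x = "\<lambda>m. \<Sum>y\<in>F m. u m y *\<^sub>R fst y"
  have xi: "?x m $ i = (\<Sum>y\<in>F m. u m y * fst y $ i)" for m i by simp
  note w1 = weights_label[OF w]
  have "0 \<le> s $ i" for i
  proof (rule LIMSEQ_le_const[OF tendsto_vec_nth[OF lim]], intro exI allI impI)
    show "0 \<le> ?x m $ i" for m
      unfolding xi using w1(1)[of _ m] F(1)[of _ m] by (intro sum_nonneg mult_nonneg_nonneg) (auto simp: nonneg_orthant_def)
  qed
  then show so: "s \<in> nonneg_orthant" by (simp add: nonneg_orthant_def)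
  show "norm s \<le> kG + k0"
  proof (rule LIMSEQ_le_const2[OF tendsto_norm[OF lim]], intro exI allI impI)
    fix m
    have "norm (?x m) \<le> (\<Sum>y\<in>F m. u m y * (kG + k0))"
      using w1(1)[of _ m] F(4)[of _ m]
      by (intro order.trans[OF norm_sum] sum_mono) (simp add: mult_left_mono less_imp_le)
    also have "\<dots> = kG + k0" using w1(2)[of m] by (simp flip: sum_distrib_right)
    finally show "norm (?x m) \<le> kG + k0" .
  qed
  have near: "norm (fst y - ?x m) \<le> d m * sqrt (real CARD('n))" if y: "y \<in> F m" for y m
  proof (rule component_le_norm_diff)
    show "\<bar>fst y $ i - ?x m $ i\<bar> \<le> d m" for i
      unfolding xi using weighted_mean_near[OF w1(1,2), of m "\<lambda>z. fst z $ i" "fst y $ i" "d m"] F(3)[OF _ y]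
      by (simp add: abs_minus_commute)
  qed (use d(2) less_imp_le in blast)
  have "(\<lambda>m. ?x m $ i) \<longlonglongrightarrow> \<phi> s $ i" for i
  proof (rule LIMSEQ_I)
    fix e :: real assume e: "0 < e"
    have "continuous_on nonneg_orthant (\<lambda>v. \<phi> v $ i)"
      using phi_continuous by (rule continuous_on_component)
    then obtain \<delta> where \<delta>: "0 < \<delta>" "\<And>v. v \<in> nonneg_orthant \<Longrightarrow> dist v s < \<delta> \<Longrightarrow> dist (\<phi> v $ i) (\<phi> s $ i) < e / 2"
      using so e unfolding continuous_on_iff by (metis half_gt_zero)
    have "(\<lambda>m. d m * sqrt (real CARD('n)) + norm (?x m - s)) \<longlonglongrightarrow> 0 * sqrt (real CARD('n)) + norm (s - s)"
      by (intro tendsto_intros d lim)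
    then have "(\<lambda>m. d m * sqrt (real CARD('n)) + norm (?x m - s)) \<longlonglongrightarrow> 0" by simp
    from LIMSEQ_D[OF this \<delta>(1)] obtain M where
      M: "\<And>m. M \<le> m \<Longrightarrow> norm (d m * sqrt (real CARD('n)) + norm (?x m - s) - 0) < \<delta>" by blast
    have "norm (?x m $ i - \<phi> s $ i) < e" if m: "M \<le> m" for m
    proof -
      have "\<bar>\<phi> (fst y) $ i - \<phi> s $ i\<bar> \<le> e / 2" if y: "y \<in> F m" for y
      proof -
        have "norm (fst y - s) \<le> norm (fst y - ?x m) + norm (?x m - s)"
          using norm_triangle_ineq[of "fst y - ?x m" "?x m - s"] by simp
        then have "dist (fst y) s < \<delta>" using near[OF y] M[OF m] by (simp add: dist_norm)
        from \<delta>(2)[OF F(1)[OF y] this] show ?thesis by (simp add: dist_real_def)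
      qed
      then have "\<bar>(\<Sum>y\<in>F m. u m y * \<phi> (fst y) $ i) - \<phi> s $ i\<bar> \<le> e / 2"
        using w1(1)[of _ m] w1(2)[of m] by (intro weighted_mean_near) blast+
      moreover have "(\<Sum>y\<in>F m. u m y * \<phi> (fst y) $ i) = ?x m $ i"
        unfolding xi w1(3)[of m i, symmetric] using F(2)[of _ m] by (intro sum.cong) simp_all
      ultimately show ?thesis using e by simp
    qed
    then show "\<exists>no. \<forall>m\<ge>no. norm (?x m $ i - \<phi> s $ i) < e" by blast
  qed
  then have "s $ i = \<phi> s $ i" for i
    using LIMSEQ_unique tendsto_vec_nth[OF lim, of i] by blast
  then show "\<phi> s = s" by (simp add: vec_eq_iff)
qed

lemma fixed_point_decay:
  assumes fp: "\<phi> s = s" and s: "s \<in> nonneg_orthant" "norm s \<le> kG + k0"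
  shows "\<Gamma> s $ i < s $ i"
proof -
  have eq: "s $ j = factor s * \<Gamma> s $ j + max 0 (kh - 2 * norm s)" for j
    using phi_component[of s j] fp by simp
  have "s \<noteq> 0"
  proof
    assume "s = 0"
    have "(kG - 2 * 0) / (0 + k0) \<ge> 0" using k0 kh khG by simp
    moreover have "0 \<le> \<Gamma> s $ i" using Gamma_nonneg[OF s(1)] .
    ultimately show False using eq[of i] \<open>s = 0\<close> kh by (simp add: factor_def)
  qed
  then obtain j where j: "\<Gamma> s $ j < s $ j" using sgc[OF s(1)] by blast
  have nk: "0 < norm s + k0" using k0 norm_ge_zero[of s] by linarith
  show ?thesis
  proof (cases "norm s \<le> kG / 2")
    case True
    then have "factor s = 1" using nk by (simp add: factor_def)
    then show ?thesis using eq[of i] eq[of j] j by simp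
  next
    case False
    then have m0: "max 0 (kh - 2 * norm s) = 0" using khG by simp
    have "(kG - 2 * norm s) / (norm s + k0) \<le> 0" using False nk by (simp add: divide_nonpos_pos)
    then have "factor s \<le> 1" by (simp add: factor_def)
    then have "factor s * \<Gamma> s $ j \<le> \<Gamma> s $ j"
      using mult_right_mono[OF _ Gamma_nonneg[OF s(1), of j], of "factor s" 1] by simp
    then show ?thesis using eq[of j] m0 j by simp
  qed
qed

end

section \<open>The path of complete simplices\<close>

lemma convex_hull_subset_region_iff: "convex hull V \<subseteq> region \<longleftrightarrow> V \<subseteq> region"
proof -
  have "convex (region :: ((real^'n) \<times> real) set)"
  proof (rule convexI)
    fix x y :: "(real^'n) \<times> real" and a b :: real
    assume xy: "x \<in> region" "y \<in> region" and ab: "0 \<le> a" "0 \<le> b" "a + b = 1"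
    have "a * snd x + b * snd y \<le> a * 1 + b * 1"
      using xy ab by (intro add_mono mult_left_mono) (auto simp: region_def)
    then show "a *\<^sub>R x + b *\<^sub>R y \<in> region"
      using xy ab by (cases x; cases y) (auto simp: region_def)
  qed
  then show ?thesis by (metis hull_minimal hull_subset order.trans)
qed

lemma regionD:
  assumes "y \<in> region"
  shows "fst y \<in> nonneg_orthant"
  using assms by (cases y) (simp add: region_def nonneg_orthant_def)

lemma facet_subset: "facet V F \<Longrightarrow> F \<subseteq> V"
  by (auto simp: facet_def)

lemma facet_card:
  fixes V :: "((real^'n::finite) \<times> real) set"
  assumes "0 < d" "simplex1 d V" "facet V F"
  shows "finite F" "card F = CARD('n option)"
  using simplex1_card[OF assms(1,2)] assms(3) by (auto simp: facet_def)

lemma start_facet_barycentric: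
  fixes F :: "((real^'n::finite) \<times> real) set"
  assumes d: "0 < d" and V: "simplex1 d V" "facet V F"
    and c: "(c, 0) \<in> rel_interior (convex hull F)"
  obtains u where "\<And>y. y \<in> F \<Longrightarrow> 0 < u y" "(\<Sum>y\<in>F. u y) = 1" "(\<Sum>y\<in>F. u y *\<^sub>R y) = (c, 0)"
proof -
  have fin: "finite F" using facet_card[OF d V] by simp
  have "\<not> affine_dependent F"
    unfolding affine_dependent_explicit_finite[OF fin]
    using simplex1_affine_independent[OF d V(1) facet_subset[OF V(2)]] by blast
  from rel_interior_convex_hull_explicit[OF this] c show thesis using that by auto
qed

text \<open>At level 0 the label is c - v, so affine independence makes the label matrix invertible,
  and the first column of the inverse consists of the barycentric coordinates of (c, 0). Interiority
  makes these positive, so every row is decided by its first entry.\<close>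

lemma start_facet_complete:
  fixes F :: "((real, 'n::{finite,linorder}) vec \<times> real) set"
  assumes d: "0 < d" and V: "simplex1 d V" "facet V F" and lev: "\<forall>y\<in>F. snd y = 0"
    and c: "(c, 0) \<in> rel_interior (convex hull F)"
  shows "complete (label c f) F"
proof -
  let ?L = "Lentry (label c f)"
  obtain u where u: "\<And>y. y \<in> F \<Longrightarrow> 0 < u y" "(\<Sum>y\<in>F. u y) = 1" "(\<Sum>y\<in>F. u y *\<^sub>R y) = (c, 0)"
    using start_facet_barycentric[OF d V c] by blast
  have L: "?L y None = 1" "?L y (Some i) = c $ i - fst y $ i" if "y \<in> F" for y i
    using lev that by (simp_all add: Lentry_def label_def)
  have ker: "\<forall>y\<in>F. w y = 0" if w: "\<And>r. (\<Sum>y\<in>F. ?L y r * w y) = 0" for w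
  proof
    fix y assume y: "y \<in> F"
    have s: "(\<Sum>y\<in>F. w y) = 0" using w[of None] by (simp add: L cong: sum.cong)
    have "(\<Sum>y\<in>F. w y * fst y $ i) = 0" for i
    proof -
      have "(\<Sum>y\<in>F. (c $ i - fst y $ i) * w y) = 0" using w[of "Some i"] by (simp add: L cong: sum.cong)
      moreover have "(\<Sum>y\<in>F. (c $ i - fst y $ i) * w y) = c $ i * (\<Sum>y\<in>F. w y) - (\<Sum>y\<in>F. w y * fst y $ i)"
        by (simp add: algebra_simps sum_subtractf sum_distrib_left)
      ultimately show ?thesis using s by simp
    qed
    then have "fst (\<Sum>y\<in>F. w y *\<^sub>R y) = 0" by (simp add: vec_eq_iff fst_sum)
    moreover have "snd (\<Sum>y\<in>F. w y *\<^sub>R y) = 0" using lev by (simp add: snd_sum)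
    ultimately have "(\<Sum>y\<in>F. w y *\<^sub>R y) = 0" by (simp add: prod_eq_iff)
    then show "w y = 0" using simplex1_affine_independent[OF d V(1) facet_subset[OF V(2)] s _ y] by blast
  qed
  obtain W where W: "\<And>r c. (\<Sum>y\<in>F. ?L y r * W y c) = (if r = c then 1 else 0)"
    using independent_imp_right_inverse[OF facet_card[OF d V] ker] by blast
  have Lu: "(\<Sum>y\<in>F. ?L y r * u y) = (if r = None then 1 else 0)" for r
  proof (cases r)
    case None
    then show ?thesis using u(2) by (simp add: L cong: sum.cong)
  next
    case (Some i)
    have "(\<Sum>y\<in>F. u y * fst y $ i) = c $ i" using arg_cong[OF u(3), of "\<lambda>p. fst p $ i"] by (simp add: fst_sum)
    moreover have "(\<Sum>y\<in>F. (c $ i - fst y $ i) * u y) = c $ i * (\<Sum>y\<in>F. u y) - (\<Sum>y\<in>F. u y * fst y $ i)"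
      by (simp add: algebra_simps sum_subtractf sum_distrib_left)
    ultimately show ?thesis using u(2) Some by (simp add: L cong: sum.cong)
  qed
  have "(\<Sum>y\<in>F. ?L y r * (W y None - u y)) = 0" for r
    using W[of r None] Lu[of r] by (simp add: right_diff_distrib sum_subtractf)
  from ker[OF this] have "\<forall>y\<in>F. W y None = u y" by simp
  then have "\<forall>y\<in>F. lexpos_row (W y)" using u(1) by (simp add: lexpos_row_def)
  then show ?thesis using W unfolding complete_def by blast
qed

text \<open>On a level 0 facet the weights are barycentric coordinates of \<open>c\<close> whatever
  \<open>f\<close> is; after division by \<open>d\<close> the integer carrier lemma applies.\<close>

lemma level0_weights_unique:
  fixes F F' :: "((real^'n::finite) \<times> real) set"
  assumes d: "0 < d" and V: "simplex1 d V" "facet V F" and lev: "\<forall>y\<in>F. snd y = 0"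
    and c: "(c, 0) \<in> rel_interior (convex hull F)"
    and V': "simplex1 d V'" "facet V' F'" and lev': "\<forall>y\<in>F'. snd y = 0"
    and w: "weights (label c f) F' v"
  shows "F' = F"
proof -
  obtain u where u: "\<And>y. y \<in> F \<Longrightarrow> 0 < u y" "(\<Sum>y\<in>F. u y) = 1" "(\<Sum>y\<in>F. u y *\<^sub>R y) = (c, 0)"
    using start_facet_barycentric[OF d V c] by blast
  obtain X where X: "kuhn X" "\<forall>x\<in>X. x None \<in> {0, 1}" "V = emb d ` X"
    using V(1) simplex1_iff_kuhn[of d V] by metis
  obtain y where y: "y \<in> X" "F = emb d ` (X - {y})" using facet_emb[OF d] V(2) X(3) by metis
  obtain X' where X': "kuhn X'" "\<forall>x\<in>X'. x None \<in> {0, 1}" "V' = emb d ` X'"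
    using V'(1) simplex1_iff_kuhn[of d V'] by metis
  obtain y' where y': "y' \<in> X'" "F' = emb d ` (X' - {y'})" using facet_emb[OF d] V'(2) X'(3) by metis
  have inj: "inj_on (emb d) A" for A :: "('n option \<Rightarrow> int) set"
    using emb_inj[OF d] by (rule inj_on_subset) simp
  have reF: "(\<Sum>x\<in>X - {y}. h (emb d x)) = (\<Sum>y\<in>F. h y)" for h :: "_ \<Rightarrow> real"
    unfolding y(2) by (simp add: sum.reindex[OF inj])
  have reF': "(\<Sum>x\<in>X' - {y'}. h (emb d x)) = (\<Sum>y\<in>F'. h y)" for h :: "_ \<Rightarrow> real"
    unfolding y'(2) by (simp add: sum.reindex[OF inj])
  have coord: "of_int (x (Some i)) = fst (emb d x) $ i / d" for x :: "'n option \<Rightarrow> int" and i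
    using d by (simp add: emb_def)
  have "X' - {y'} = X - {y}"
  proof (rule level0_carrier_unique[OF X(1) y(1) X(2) _ X'(1) y'(1) X'(2), where p = "\<lambda>i. c $ i / d"
        and u = "\<lambda>x. u (emb d x)" and v = "\<lambda>x. v (emb d x)"])
    show "\<forall>x\<in>X - {y}. x None = 0" using lev y(2) by (auto simp: emb_def)
    show "\<forall>x\<in>X' - {y'}. x None = 0" using lev' y'(2) by (auto simp: emb_def)
    show "0 < u (emb d x)" if "x \<in> X - {y}" for x using u(1) y(2) that by blast
    show "0 \<le> v (emb d x)" if "x \<in> X' - {y'}" for x using weights_label(1)[OF w] y'(2) that by blast
    show "(\<Sum>x\<in>X - {y}. u (emb d x)) = 1" using reF[of u] u(2) by simp
    show "(\<Sum>x\<in>X' - {y'}. v (emb d x)) = 1" using reF'[of v] weights_label(2)[OF w] by simp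
    fix i
    have "(\<Sum>y\<in>F. u y * fst y $ i) = c $ i" using arg_cong[OF u(3), of "\<lambda>p. fst p $ i"] by (simp add: fst_sum)
    then show "(\<Sum>x\<in>X - {y}. u (emb d x) * of_int (x (Some i))) = c $ i / d"
      unfolding coord using reF[of "\<lambda>y. u y * (fst y $ i / d)"] by (simp flip: sum_divide_distrib)
    have "(\<Sum>y\<in>F'. v y * fst y $ i) = (\<Sum>y\<in>F'. v y * ((1 - snd y) * c $ i + snd y * f (fst y) $ i))"
      using weights_label(3)[OF w] by simp
    also have "\<dots> = (\<Sum>y\<in>F'. v y * c $ i)" using lev' by (intro sum.cong) simp_all
    also have "\<dots> = c $ i" using weights_label(2)[OF w] by (simp flip: sum_distrib_right)
    finally show "(\<Sum>x\<in>X' - {y'}. v (emb d x) * of_int (x (Some i))) = c $ i / d"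
      unfolding coord using reF'[of "\<lambda>y. v y * (fst y $ i / d)"] by (simp flip: sum_divide_distrib)
  qed
  then show ?thesis by (simp add: y(2) y'(2))
qed

text \<open>The conclusion \<open>F \<union> F' = V\<close> records that the facets omit different
  vertices; it later prevents both from being shared with one and the same neighbour.\<close>

lemma Gnode_two_complete_facets:
  fixes V :: "((real, 'n::{finite,linorder}) vec \<times> real) set"
  assumes d: "0 < d" and V: "simplex1 d V" and F: "facet V F" "complete lab F"
  obtains F' where "F' \<noteq> F" "facet V F'" "complete lab F'" "F \<union> F' = V"
    "\<And>H. facet V H \<Longrightarrow> complete lab H \<Longrightarrow> H = F \<or> H = F'"
proof -
  obtain y where y: "y \<in> V" "F = V - {y}" using F(1) by (auto simp: facet_def)
  obtain y' where y': "y' \<in> V" "y' \<noteq> y" "complete lab (V - {y'})"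
    and uniq: "\<And>w. w \<in> V \<Longrightarrow> w \<noteq> y \<Longrightarrow> complete lab (V - {w}) \<Longrightarrow> w = y'"
    using other_complete_facet[OF simplex1_card[OF d V] y(1), of lab] F(2) y(2) by metis
  show thesis
  proof (rule that)
    show "V - {y'} \<noteq> F" "F \<union> (V - {y'}) = V" using y y' by auto
    show "facet V (V - {y'})" using y' by (auto simp: facet_def)
    show "complete lab (V - {y'})" by (rule y'(3))
    fix H assume H: "facet V H" "complete lab H"
    then obtain w where w: "w \<in> V" "H = V - {w}" by (auto simp: facet_def)
    then show "H = F \<or> H = V - {y'}" using uniq[of w] H y(2) by blast
  qed
qed

text \<open>The combinatorial core for an arbitrary labeling. The analysis of phi enters only
  through \<open>level0\<close>, \<open>bound\<close> and \<open>lateral\<close>, statements about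
  complete facets inside the region.\<close>

lemma path_from_start_simplex:
  fixes lab :: "(real, 'n::{finite,linorder}) vec \<times> real \<Rightarrow> (real, 'n) vec"
  assumes d: "0 < d"
    and eta: "simplex1 d eta0" "eta0 \<subseteq> region" "facet eta0 tau0"
    and tau: "\<forall>y\<in>tau0. snd y = 0" "complete lab tau0"
    and level0: "\<And>V F. simplex1 d V \<Longrightarrow> V \<subseteq> region \<Longrightarrow> facet V F \<Longrightarrow> complete lab F \<Longrightarrow>
        (\<forall>y\<in>F. snd y = 0) \<Longrightarrow> F = tau0"
    and bound: "\<And>V F y. simplex1 d V \<Longrightarrow> V \<subseteq> region \<Longrightarrow> facet V F \<Longrightarrow> complete lab F \<Longrightarrow>
        y \<in> F \<Longrightarrow> norm (fst y) < R"
    and lateral: "\<And>V F i. simplex1 d V \<Longrightarrow> V \<subseteq> region \<Longrightarrow> facet V F \<Longrightarrow> complete lab F \<Longrightarrow>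
        \<not> (\<forall>y\<in>F. fst y $ i = 0)"
  shows "\<exists>p. component_is_path d lab eta0 p"
proof -
  let ?E = "Gadj d lab"
  have node_iff: "Gnode d lab V \<longleftrightarrow> simplex1 d V \<and> V \<subseteq> region \<and> (\<exists>F. facet V F \<and> complete lab F)" for V
    unfolding Gnode_def convex_hull_subset_region_iff by (rule refl)
  have node_eta: "Gnode d lab eta0" using eta tau(2) unfolding node_iff by blast
  have node: "Gnode d lab V" if "?E\<^sup>*\<^sup>* eta0 V" for V
    using that by (induction rule: rtranclp_induct) (use node_eta Gadj_def in blast)+
  have node_simplex: "simplex1 d V" "V \<subseteq> region" if "Gnode d lab V" for V using that node_iff by blast+
  have adjD: "Gnode d lab A \<and> Gnode d lab B \<and> A \<noteq> B" if "?E A B" for A B using that Gadj_def by blast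
  have tau_only: "V = eta0" if "simplex1 d V" "facet V tau0" for V
    using level0_coface_unique[OF d eta(1,3) that tau(1)] .
  have via: "A = B" if "?E V A" "?E V B" "facet V F" "facet A F" "facet B F" for V A B F
    using coface_unique[OF d _ that(3) _ that(4) _ that(5)] that(1,2) adjD node_simplex(1) by metis
  have deg2: "A = B \<or> A = C \<or> B = C" if E: "?E V A" "?E V B" "?E V C" for V A B C
  proof -
    obtain FA where FA: "facet V FA" "facet A FA" "complete lab FA" using E(1) Gadj_def by blast
    obtain FB where FB: "facet V FB" "facet B FB" "complete lab FB" using E(2) Gadj_def by blast
    obtain FC where FC: "facet V FC" "facet C FC" "complete lab FC" using E(3) Gadj_def by blast
    have "simplex1 d V" using E(1) adjD node_simplex by blast
    \<comment> \<open>Three neighbours share at most two complete facets, so two of them use the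
      same one.\<close>
    from Gnode_two_complete_facets[OF d this FA(1,3)] obtain F'
      where "\<And>H. facet V H \<Longrightarrow> complete lab H \<Longrightarrow> H = FA \<or> H = F'" by metis
    then have "FA = FB \<or> FA = FC \<or> FB = FC" using FB FC by metis
    then show ?thesis using via E FA FB FC by metis
  qed
  obtain tau1 where tau1: "tau1 \<noteq> tau0" "facet eta0 tau1" "complete lab tau1"
    and only: "\<And>H. facet eta0 H \<Longrightarrow> complete lab H \<Longrightarrow> H = tau0 \<or> H = tau1"
    using Gnode_two_complete_facets[OF d eta(1,3) tau(2)] by metis
  have deg1: "A = B" if E: "?E eta0 A" "?E eta0 B" for A B
  proof -
    have "facet A tau1" if "?E eta0 A" for A
    proof -
      obtain F where F: "facet eta0 F" "facet A F" "complete lab F" using \<open>?E eta0 A\<close> Gadj_def by blast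
      \<comment> \<open>A neighbour through \<open>tau0\<close> would be a second coface of a facet
        at level 0.\<close>
      have "F \<noteq> tau0" using tau_only[of A] F(2) adjD[OF that] node_simplex(1) by metis
      then show ?thesis using only F by metis
    qed
    then show ?thesis using via[OF E tau1(2)] E by blast
  qed
  have "finite {V. ?E\<^sup>*\<^sup>* eta0 V}"
  \<comment> \<open>The radius \<open>R\<close> is known only for vertices of a complete facet; the
    remaining vertex of a node is within \<open>d\<close> of these in each coordinate.\<close>
  proof (rule finite_subset[OF _ finite_bounded_simplex1[OF d, of "R + d"]], rule subsetI, unfold mem_Collect_eq, intro conjI ballI allI)
    fix V assume "?E\<^sup>*\<^sup>* eta0 V"
    then have V: "Gnode d lab V" by (rule node)
    show "simplex1 d V" "V \<subseteq> region" using node_simplex[OF V] .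
    fix y i assume y: "y \<in> V"
    obtain F where F: "facet V F" "complete lab F" using V node_iff by blast
    have "card F \<noteq> 0" using facet_card(2)[OF d node_simplex(1)[OF V] F(1)] by simp
    then obtain x where x: "x \<in> F" by (metis card.empty ex_in_conv)
    have "fst x $ i \<le> norm (fst x)" using component_le_norm_cart[of "fst x" i] by linarith
    moreover have "\<bar>fst y $ i - fst x $ i\<bar> \<le> d"
      using simplex1_vertex_near[OF d node_simplex(1)[OF V] y] facet_subset[OF F(1)] x by blast
    ultimately show "fst y $ i \<le> R + d" using bound[OF node_simplex[OF V] F x] by linarith
  qed
  then have "\<exists>p. p \<noteq> [] \<and> distinct p \<and> hd p = eta0 \<and> set p = {v. ?E\<^sup>*\<^sup>* eta0 v} \<and>
     (\<forall>a\<in>set p. \<forall>b\<in>set p. ?E a b \<longleftrightarrow>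
        (\<exists>i. Suc i < length p \<and> ((a = p ! i \<and> b = p ! Suc i) \<or> (b = p ! i \<and> a = p ! Suc i))))"
  proof (rule degree_two_component_is_path)
    show "?E B A" if "?E A B" for A B using that unfolding Gadj_def by metis
    show "\<not> ?E A A" for A by (simp add: Gadj_def)
  qed (fact deg2 deg1)+
  then obtain p where p: "p \<noteq> []" "distinct p" "hd p = eta0" "set p = {v. ?E\<^sup>*\<^sup>* eta0 v}"
    and adj: "\<forall>a\<in>set p. \<forall>b\<in>set p. ?E a b \<longleftrightarrow>
        (\<exists>i. Suc i < length p \<and> ((a = p ! i \<and> b = p ! Suc i) \<or> (b = p ! i \<and> a = p ! Suc i)))"
    by (elim exE conjE) (rule that)
  define V where "V = last p"
  have Vp: "V \<in> set p" using p(1) by (simp add: V_def)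
  then have V: "Gnode d lab V" using node p(4) by blast
  have nb_unique: "A = B" if "?E V A" "?E V B" for A B
  proof -
    have "A = p ! (length p - 2)" if E: "?E V A" for A
    proof -
      have "A \<in> set p" using Vp E unfolding p(4) by auto
      then obtain i where i: "Suc i < length p" "(V = p ! i \<and> A = p ! Suc i) \<or> (A = p ! i \<and> V = p ! Suc i)"
        using adj Vp E by blast
      have Vl: "V = p ! (length p - 1)" using p(1) by (simp add: V_def last_conv_nth)
      have "V \<noteq> p ! i" using i(1) p(2) Vl by (simp add: nth_eq_iff_index_eq)
      then have "A = p ! i" "p ! (length p - 1) = p ! Suc i" using i(2) Vl by auto
      then have "length p - 1 = Suc i" using i(1) p(2) by (simp add: nth_eq_iff_index_eq)
      then show ?thesis using \<open>A = p ! i\<close> by (metis diff_Suc_1 diff_diff_left one_add_one plus_1_eq_Suc)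
    qed
    then show ?thesis using that by metis
  qed
  have "\<exists>F. facet V F \<and> complete lab F \<and> (\<forall>y\<in>F. snd y = 1)"
  proof (rule ccontr)
    assume none: "\<not> ?thesis"
    have nb: "\<exists>A. ?E V A \<and> facet A F" if F: "facet V F" "complete lab F" "F \<noteq> tau0" for F
    proof -
      have "\<not> (\<forall>y\<in>F. snd y = 0)" using level0[OF node_simplex[OF V] F(1,2)] F(3) by blast
      moreover have "\<not> (\<forall>y\<in>F. snd y = 1)" using none F by blast
      ultimately obtain A where A: "A \<noteq> V" "simplex1 d A" "A \<subseteq> region" "facet A F"
        using coface_exists[OF d node_simplex[OF V] F(1) _ _ lateral[OF node_simplex[OF V] F(1,2)]] by metis
      then have "Gnode d lab A" using F(2) node_iff by blast
      then have "?E V A" unfolding Gadj_def using V A F by blast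
      then show ?thesis using A(4) by blast
    qed
    show False
    proof (cases "V = eta0")
      case True
      then obtain A where A: "?E V A" using nb[of tau1] tau1 by blast
      have "length p = 1"
      proof -
        have "p ! (length p - 1) = p ! 0" using True p(1,3) by (simp add: V_def last_conv_nth hd_conv_nth)
        then have "length p - 1 = 0" using p(1,2) by (simp add: nth_eq_iff_index_eq)
        then show ?thesis using p(1) by (cases p) auto
      qed
      moreover have "A \<in> set p" using Vp A unfolding p(4) by auto
      ultimately show False using adj Vp A by auto
    next
      case False
      obtain F where F: "facet V F" "complete lab F" using V node_iff by blast
      obtain F' where F': "facet V F'" "complete lab F'" "F \<union> F' = V"
        using Gnode_two_complete_facets[OF d node_simplex(1)[OF V] F] by metis
      have "F \<noteq> tau0" "F' \<noteq> tau0" using tau_only[OF node_simplex(1)[OF V]] F F' False by blast+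
      then obtain A A' where A: "?E V A" "facet A F" "?E V A'" "facet A' F'" using nb F F' by metis
      \<comment> \<open>The last vertex of the path has at most one neighbour, so both facets lie in
        one simplex \<open>A\<close>, which then contains all of \<open>V\<close> and equals it by
        cardinality.\<close>
      have "A = A'" using nb_unique A by blast
      then have "V \<subseteq> A" using F'(3) A facet_subset by blast
      moreover have "A \<noteq> V" "simplex1 d A" using A(1) adjD node_simplex by metis+
      ultimately show False
        using simplex1_card[OF d node_simplex(1)[OF V]] simplex1_card[OF d \<open>simplex1 d A\<close>] card_subset_eq by metis
    qed
  qed
  then have "component_is_path d lab eta0 p"
    unfolding component_is_path_def V_def using p adj by blast
  then show ?thesis ..
qed

text \<open>An accumulation point is expressed as a limit along a strictly increasing index sequence
  \<open>r\<close>. In the second part \<open>ps\<close>, \<open>taus\<close> and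
  \<open>lams\<close> are arbitrary witnesses, so the conclusion covers every choice of terminal
  facet and weights.\<close>

theorem mainTheorem6:
  fixes g :: "'n::{finite,linorder} \<Rightarrow> 'n \<Rightarrow> real \<Rightarrow> real"
    and mu :: "'n \<Rightarrow> (real, 'n) vec \<Rightarrow> real"
    and k0 kG kh :: real and c :: "(real, 'n) vec" and k :: nat
  defines "\<phi> \<equiv> phi_map k0 kG kh mu g"
  assumes gains: "\<forall>i j. Kinf (g i j) \<or> zero_fun_R (g i j)"
    and irred: "irreducible_gain g"
    and maf: "\<forall>i. MAF (mu i)"
    and sgc: "\<forall>s\<in>nonneg_orthant - {0}. \<not> (\<forall>i. Gamma_mu mu g s $ i \<ge> s $ i)"
    and k0: "0 < k0" and kh: "0 < kh" and khG: "kh < kG"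
    and cpos: "\<forall>i. 0 < c $ i" and cnorm: "norm c < kG / 2"
    and k: "1 \<le> k"
    and kmax: "\<forall>i. (1 / (2 * real k - 1)) * Gamma_mu mu g ((kG + k0) *\<^sub>R onevec) $ i < c $ i"
  shows
    "(\<forall>d tau0 eta0. admissible k0 kG kh k c d tau0 eta0 \<longrightarrow>
        (\<exists>p. component_is_path d (label c \<phi>) eta0 p))
     \<and>
     (\<forall>(ds :: nat \<Rightarrow> real) tau0s eta0s ps taus lams (r :: nat \<Rightarrow> nat) s.
        (\<forall>m. admissible k0 kG kh k c (ds m) (tau0s m) (eta0s m)
             \<and> component_is_path (ds m) (label c \<phi>) (eta0s m) (ps m)
             \<and> facet (last (ps m)) (taus m) \<and> complete (label c \<phi>) (taus m)
             \<and> (\<forall>y\<in>taus m. snd y = 1)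
             \<and> (\<forall>y\<in>taus m. 0 \<le> lams m y)
             \<and> (\<forall>row. (\<Sum>y\<in>taus m. Lentry (label c \<phi>) y row * lams m y)
                       = (if row = None then 1 else 0)))
        \<and> ds \<longlonglongrightarrow> 0
        \<and> strict_mono r
        \<and> (\<lambda>m. \<Sum>y\<in>taus (r m). lams (r m) y *\<^sub>R fst y) \<longlonglongrightarrow> s
        \<longrightarrow> \<phi> s = s \<and> (\<forall>i. Gamma_mu mu g s $ i < s $ i))"
proof -
  interpret gain_network g mu k0 kG kh
  proof
    show "\<exists>i. Gamma_mu mu g s $ i < s $ i" if "s \<in> nonneg_orthant" "s \<noteq> 0" for s
      using sgc that by (meson DiffI not_le singletonD)
  qed (use gains irred maf k0 kh khG in auto)
  let ?lab = "label c \<phi>"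
  have facet_props: "fst y \<in> nonneg_orthant" "snd y = 0 \<or> snd y = 1" "\<bar>fst y $ i - fst z $ i\<bar> \<le> d"
    if "0 < d" "simplex1 d V" "V \<subseteq> region" "facet V F" "y \<in> F" "z \<in> F" for d V F y z i
    using facet_subset[OF that(4)] that regionD simplex1_level[OF that(2)] simplex1_vertex_near[OF that(1,2)]
    by blast+
  have bound: "norm (fst y) < kG + k0"
    if d: "0 < d" "d < (kG + 2 * k0) / (2 * real k * sqrt (real CARD('n)))"
      and V: "simplex1 d V" "V \<subseteq> region" "facet V F" and w: "weights ?lab F u" and y: "y \<in> F" for d V F u y
    using w unfolding \<phi>_def
  proof (rule weights_norm_bound[OF _ _ _ _ d k cnorm _ y])
    show "(1 / (2 * real k - 1)) * Gamma_mu mu g ((kG + k0) *\<^sub>R onevec) $ i < c $ i" for i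
      using kmax by blast
  qed (use facet_props[OF d(1) V] in blast)+
  have admD: "0 < d" "d < (kG + 2 * k0) / (2 * real k * sqrt (real CARD('n)))" "simplex1 d eta0" "eta0 \<subseteq> region"
      "facet eta0 tau0" "\<forall>y\<in>tau0. snd y = 0" "(c, 0) \<in> rel_interior (convex hull tau0)"
    if "admissible k0 kG kh k c d tau0 eta0" for d tau0 eta0
    using that unfolding admissible_def convex_hull_subset_region_iff by blast+
  show ?thesis
  proof (intro conjI allI impI, goal_cases)
    case (1 d tau0 eta0)
    note a = admD[OF 1]
    have wts: "\<exists>u. weights ?lab F u" if "complete ?lab F" for F
      using complete_imp_weights[OF that] unfolding weights_def by metis
    show ?case
    proof (rule path_from_start_simplex[OF a(1,3-6)])
      show "complete ?lab tau0" using start_facet_complete[OF a(1,3,5-7)] .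
      fix V F assume V: "simplex1 d V" "V \<subseteq> region" "facet V F" and F: "complete ?lab F"
      obtain u where u: "weights ?lab F u" using wts[OF F] by blast
      show "F = tau0" if "\<forall>y\<in>F. snd y = 0"
        using level0_weights_unique[OF a(1,3,5-7) V(1,3) that u] .
      show nb: "norm (fst y) < kG + k0" if "y \<in> F" for y
        using bound[OF a(1,2) V u that] .
      show "\<not> (\<forall>y\<in>F. fst y $ i = 0)" for i
      proof (rule weights_not_lateral[OF u[unfolded \<phi>_def] facet_card(1)[OF a(1) V(1,3)]])
        show "0 < c $ i" for i using cpos by blast
      qed (use facet_props[OF a(1) V] nb in blast)+
    qed
  next
    case (2 ds tau0s eta0s ps taus lams r s)
    then have H: "admissible k0 kG kh k c (ds m) (tau0s m) (eta0s m)"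
      "component_is_path (ds m) ?lab (eta0s m) (ps m)" "facet (last (ps m)) (taus m)"
      "\<forall>y\<in>taus m. snd y = 1" "weights ?lab (taus m) (lams m)" for m
      unfolding weights_def by blast+
    have V: "simplex1 (ds m) (last (ps m))" "last (ps m) \<subseteq> region" for m
    proof -
      have "last (ps m) \<in> {V. (Gadj (ds m) ?lab)\<^sup>*\<^sup>* (eta0s m) V}"
        using H(2)[of m] unfolding component_is_path_def by (metis last_in_set)
      then have "(Gadj (ds m) ?lab)\<^sup>*\<^sup>* (eta0s m) (last (ps m))" by simp
      then have "simplex1 (ds m) (last (ps m)) \<and> last (ps m) \<subseteq> region"
      \<comment> \<open>Reachability yields a node only after at least one edge; for a path that
        stops at its start, admissibility gives the same facts.\<close>
      proof (cases rule: rtranclp.cases)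
        case rtrancl_refl
        then show ?thesis using admD(3,4)[OF H(1)[of m]] by simp
      next
        case (rtrancl_into_rtrancl b)
        then show ?thesis unfolding Gadj_def Gnode_def convex_hull_subset_region_iff by blast
      qed
      then show "simplex1 (ds m) (last (ps m))" "last (ps m) \<subseteq> region" by blast+
    qed
    note d = admD(1,2)[OF H(1)]
    note fp = facet_props[OF d(1) V H(3)]
    have w: "weights (label c (phi_map k0 kG kh mu g)) (taus (r m)) (lams (r m))" for m
      using H(5)[of "r m"] by (simp add: \<phi>_def)
    have orthant: "fst y \<in> nonneg_orthant" if "y \<in> taus (r m)" for m y
      using fp(1)[OF that that] .
    have level: "snd y = 1" if "y \<in> taus (r m)" for m y
      using H(4) that by blast
    have near: "\<bar>fst x $ i - fst y $ i\<bar> \<le> ds (r m)" if "x \<in> taus (r m)" "y \<in> taus (r m)" for m x y i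
      using fp(3)[OF that] .
    have norm: "norm (fst y) < kG + k0" if "y \<in> taus (r m)" for m y
      using bound[OF d V H(3,5) that] .
    have lim: "(\<lambda>m. ds (r m)) \<longlonglongrightarrow> 0" using 2 LIMSEQ_subseq_LIMSEQ[of ds 0 r] by (simp add: comp_def)
    have lim_s: "(\<lambda>m. \<Sum>y\<in>taus (r m). lams (r m) y *\<^sub>R fst y) \<longlonglongrightarrow> s" using 2 by blast
    note fixp = approximate_fixed_points_limit[OF w orthant level near norm lim d(1) lim_s]
    show "\<phi> s = s" using fixp(1) by (simp add: \<phi>_def)
    show "Gamma_mu mu g s $ i < s $ i" for i using fixed_point_decay[OF fixp] .
  qed
qed

end
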